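(* Let $\mathfrak{A}$ be a unital $C^*$-algebra, let $(\mathcal{H},\pi)$ be a nonzero irreducible representation of $\mathfrak{A}$, and let $n$ be a positive integer. Let $$X_{\mathrm{u}}=\{(\mathbf{x},\mathbf{y})\in\mathcal{H}^{2n} : x_1,\ldots,x_n \text{ are linearly independent and there exists } T\in\mathsf{U}(\mathcal{H}) \text{ such that } Tx_i=y_i \text{ for all } i=1,\ldots,n\},$$ equipped with the subspace topology. For every $(\mathbf{x}_0,\mathbf{y}_0)\in X_{\mathrm{u}}$ there exist a neighborhood $O\subset X_{\mathrm{u}}$ of $(\mathbf{x}_0,\mathbf{y}_0)$ and a continuous map $U:O\to\mathsf{U}(\mathfrak{A})$ such that $$\pi(U(\mathbf{x},\mathbf{y}))x_i=y_i\quad\text{for all } i=1,\ldots,n$$ for all $(\mathbf{x},\mathbf{y})\in O$.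
   Context: Hilbert spaces are complex. $\mathsf{U}(\mathcal{H})$ is the unitary group of the Hilbert space $\mathcal{H}$ and $\mathsf{U}(\mathfrak{A})$ is the group of unitary elements of $\mathfrak{A}$ with the norm topology. Bold letters denote $n$-tuples $\mathbf{x}=(x_1,\ldots,x_n)\in\mathcal{H}^n$, and elements of $\mathcal{H}^{2n}$ are written as pairs $(\mathbf{x},\mathbf{y})$ of $n$-tuples; $\mathcal{H}^{2n}$ carries its Hilbert space norm topology. *)

theory Defs
  imports "HOL-Analysis.Analysis"
begin

section \<open>Complex vector spaces and complex Hilbert spaces\<close>

class scaleC = scaleR +
  fixes scaleC :: "complex \<Rightarrow> 'a \<Rightarrow> 'a"  (infixr \<open>*\<^sub>C\<close> 75)
  assumes scaleR_scaleC: "r *\<^sub>R x = complex_of_real r *\<^sub>C x"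

class complex_vector = scaleC + ab_group_add +
  assumes scaleC_add_right: "c *\<^sub>C (x + y) = c *\<^sub>C x + c *\<^sub>C y"
    and scaleC_add_left: "(c + d) *\<^sub>C x = c *\<^sub>C x + d *\<^sub>C x"
    and scaleC_scaleC: "c *\<^sub>C (d *\<^sub>C x) = (c * d) *\<^sub>C x"
    and scaleC_one: "1 *\<^sub>C x = x"

global_interpretation complex_vector:
  vector_space "scaleC :: complex \<Rightarrow> 'a \<Rightarrow> 'a::complex_vector"
  by unfold_locales (simp_all add: scaleC_add_right scaleC_add_left scaleC_scaleC scaleC_one)

class complex_normed_vector = complex_vector + real_normed_vector +
  assumes norm_scaleC: "norm (c *\<^sub>C x) = cmod c * norm x"

text \<open>The inner product is conjugate-linear in its first argument; linearity there and
  positive definiteness follow from the axioms below.\<close>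

class chilbert_space = complex_normed_vector + complete_space +
  fixes cinner :: "'a \<Rightarrow> 'a \<Rightarrow> complex"
  assumes cinner_commute: "cinner x y = cnj (cinner y x)"
    and cinner_add_right: "cinner x (y + z) = cinner x y + cinner x z"
    and cinner_scaleC_right: "cinner x (c *\<^sub>C y) = c * cinner x y"
    and cinner_norm: "cinner x x = complex_of_real ((norm x)\<^sup>2)"

definition bounded_clinear ::
    "('a::complex_normed_vector \<Rightarrow> 'b::complex_normed_vector) \<Rightarrow> bool" where
  "bounded_clinear f \<longleftrightarrow>
     Vector_Spaces.linear scaleC scaleC f \<and> (\<exists>K. \<forall>x. norm (f x) \<le> norm x * K)"

definition is_cadjoint ::
    "('h::chilbert_space \<Rightarrow> 'h) \<Rightarrow> ('h \<Rightarrow> 'h) \<Rightarrow> bool" where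
  "is_cadjoint S T \<longleftrightarrow> (\<forall>x y. cinner (T x) y = cinner x (S y))"

definition unitary_operators :: "('h::chilbert_space \<Rightarrow> 'h) set" where
  "unitary_operators =
     {T. bounded_clinear T \<and>
         (\<exists>S. bounded_clinear S \<and> is_cadjoint S T \<and> S \<circ> T = id \<and> T \<circ> S = id)}"


section \<open>Unital C*-algebras\<close>

text \<open>The superclass \<^class>\<open>real_normed_algebra_1\<close> contains \<open>norm 1 = 1\<close>, so exactly the
  zero algebra is excluded; that algebra has no nonzero representations.\<close>

class unital_cstar_algebra = complex_normed_vector + real_normed_algebra_1 + complete_space +
  fixes star :: "'a \<Rightarrow> 'a"
  assumes mult_scaleC_left: "(c *\<^sub>C a) * b = c *\<^sub>C (a * b)"
    and mult_scaleC_right: "a * (c *\<^sub>C b) = c *\<^sub>C (a * b)"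
    and star_add: "star (a + b) = star a + star b"
    and star_scaleC: "star (c *\<^sub>C a) = cnj c *\<^sub>C star a"
    and star_mult: "star (a * b) = star b * star a"
    and star_star: "star (star a) = a"
    and norm_star_mult_self: "norm (star a * a) = (norm a)\<^sup>2"

definition unitary_elements :: "'a::unital_cstar_algebra set" where
  "unitary_elements = {u. star u * u = 1 \<and> u * star u = 1}"


section \<open>Representations\<close>

text \<open>A representation is a *-homomorphism into the bounded operators; it is not required to
  preserve the unit.\<close>

definition star_representation ::
    "('a::unital_cstar_algebra \<Rightarrow> 'h::chilbert_space \<Rightarrow> 'h) \<Rightarrow> bool" where
  "star_representation \<pi> \<longleftrightarrow>
     (\<forall>a. bounded_clinear (\<pi> a)) \<and>
     (\<forall>a b v. \<pi> (a + b) v = \<pi> a v + \<pi> b v) \<and>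
     (\<forall>c a v. \<pi> (c *\<^sub>C a) v = c *\<^sub>C \<pi> a v) \<and>
     (\<forall>a b. \<pi> (a * b) = \<pi> a \<circ> \<pi> b) \<and>
     (\<forall>a. is_cadjoint (\<pi> (star a)) (\<pi> a))"

definition nonzero_representation ::
    "('a::unital_cstar_algebra \<Rightarrow> 'h::chilbert_space \<Rightarrow> 'h) \<Rightarrow> bool" where
  "nonzero_representation \<pi> \<longleftrightarrow> (\<exists>a v. \<pi> a v \<noteq> 0)"

definition irreducible_representation ::
    "('a::unital_cstar_algebra \<Rightarrow> 'h::chilbert_space \<Rightarrow> 'h) \<Rightarrow> bool" where
  "irreducible_representation \<pi> \<longleftrightarrow>
     star_representation \<pi> \<and>
     (\<forall>M. complex_vector.subspace M \<and> closed M \<and> (\<forall>a. \<pi> a ` M \<subseteq> M) \<longrightarrow> M = {0} \<or> M = UNIV)"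


section \<open>The space of unitarily related tuples\<close>

definition clinearly_independent :: "'h::complex_vector ^ 'n \<Rightarrow> bool" where
  "clinearly_independent x \<longleftrightarrow>
     (\<forall>c :: 'n \<Rightarrow> complex. (\<Sum>i\<in>UNIV. c i *\<^sub>C (x $ i)) = 0 \<longrightarrow> (\<forall>i. c i = 0))"

text \<open>The norm on \<^typ>\<open>('h::real_normed_vector ^ 'n) \<times> ('h ^ 'n)\<close> is the l2-norm of the
  component norms, that is, the norm of the Hilbert space direct sum.\<close>

definition X_u :: "(('h::chilbert_space ^ 'n) \<times> ('h ^ 'n)) set" where
  "X_u = {(x, y). clinearly_independent x \<and> (\<exists>T\<in>unitary_operators. \<forall>i. T (x $ i) = y $ i)}"

end

theory Submission
  imports Defs
begin

text \<open>
  The problem is linearised by the Cayley transform. For self-adjoint \<open>h\<close> the element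
  \<open>u = (1 + ih) (1 - ih)\<^sup>-\<^sup>1\<close> is unitary, and \<open>\<pi>(u)x = y\<close> is equivalent to
  \<open>\<pi>(h)(x + y) = -i(y - x)\<close> (\<open>rep_cayley\<close>). Thus a unitary solution that depends continuously on
  \<open>(x, y)\<close> is obtained from a self-adjoint solution \<open>h\<close> of \<open>\<pi>(h)\<xi> = \<eta>\<close> that depends
  continuously on \<open>\<xi> = x + y\<close> and \<open>\<eta> = -i(y - x)\<close>, once \<open>\<xi>\<close> is linearly independent. The latter is
  arranged by multiplying \<open>y\<close> with a phase: a unitary operator has only finitely many eigenvalues on
  the span of \<open>x\<close> (\<open>independent_rotated_sum\<close>). The equality of the Gram matrices of \<open>x\<close> and \<open>y\<close>
  becomes the symmetry \<open>\<langle>\<xi>\<^sub>i, \<eta>\<^sub>j\<rangle> = \<langle>\<eta>\<^sub>i, \<xi>\<^sub>j\<rangle>\<close>.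

  For a fixed linearly independent \<open>\<xi>\<close> the map \<open>h \<mapsto> \<pi>(h)\<xi>\<close> is bounded and real linear from the
  self-adjoint elements to the closed real subspace of tuples with this symmetry, and a continuous
  solution is a continuous right inverse of it (\<open>selfadjoint_section\<close>). Such right inverses exist as
  soon as the map is approximately onto with norm control (\<open>continuous_right_inverse\<close>); this is the
  theorem of Bartle and Graves, proved with a continuous partition of unity on the unit sphere of a
  possibly nonseparable space (\<open>metric_partition_of_unity\<close>). From a fixed \<open>\<xi>\<^sub>0\<close> one passes to
  nearby \<open>\<xi>\<close> by conjugating with an invertible element that carries \<open>\<xi>\<^sub>0\<close> to \<open>\<xi>\<close>.

  Approximate surjectivity comes from irreducibility. Schur's lemma (\<open>schur\<close>) and the
  double commutant argument give density of \<open>\<pi>(\<AA>)\<close> in the bounded operators in the strong topology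
  (\<open>density\<close>), and density within the self-adjoint parts (\<open>density_selfadjoint\<close>). The norm control is
  obtained as in Kaplansky's density theorem, replacing an approximating self-adjoint \<open>b\<close> by the
  bounded function \<open>2b (1 + b\<^sup>2)\<^sup>-\<^sup>1\<close> of it (\<open>approximate_interpolation\<close>).

  The functional calculus behind these steps is elementary: square roots \<open>(1 - s)\<^bsup>1/2\<^esup>\<close> for \<open>\<parallel>s\<parallel> \<le> 1\<close>
  come from a monotone iteration (\<open>sqrt_iteration_limit\<close>), and the resolvents \<open>(1 - ih)\<^sup>-\<^sup>1\<close> from Neumann
  series and a continuation argument (\<open>cayley_resolvent_exists\<close>).\<close>


section \<open>Complex Hilbert spaces\<close>

instance chilbert_space \<subseteq> banach ..
instance unital_cstar_algebra \<subseteq> banach ..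

lemma bounded_bilinear_scaleC:
  "bounded_bilinear (scaleC :: complex \<Rightarrow> 'a \<Rightarrow> 'a::complex_normed_vector)"
proof
  show "(r *\<^sub>R a) *\<^sub>C b = r *\<^sub>R (a *\<^sub>C b)" for r and a and b :: 'a
    by (simp add: scaleR_scaleC scaleC_scaleC scaleR_conv_of_real)
  show "a *\<^sub>C (r *\<^sub>R b) = r *\<^sub>R (a *\<^sub>C b)" for r and a and b :: 'a
    by (simp add: scaleR_scaleC scaleC_scaleC mult.commute)
  show "\<exists>K. \<forall>a (b::'a). norm (a *\<^sub>C b) \<le> norm a * norm b * K"
    by (rule exI[of _ 1]) (simp add: norm_scaleC)
qed (simp_all add: scaleC_add_left scaleC_add_right)

interpretation scaleC: bounded_bilinear
  "scaleC :: complex \<Rightarrow> 'a \<Rightarrow> 'a::complex_normed_vector"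
  by (rule bounded_bilinear_scaleC)

lemmas scaleC_simps = scaleC.zero_left scaleC.zero_right scaleC.minus_left scaleC.minus_right
  scaleC.diff_left scaleC.diff_right scaleC_add_left scaleC_add_right scaleC_scaleC scaleC_one

lemma scaleR_scaleC_commute: "r *\<^sub>R (c *\<^sub>C x) = c *\<^sub>C (r *\<^sub>R (x::'a::complex_vector))"
  by (simp add: scaleR_scaleC scaleC_scaleC mult.commute)

lemma complex_subspaceI:
  assumes "(0::'a::complex_vector) \<in> M" "\<And>x y. x \<in> M \<Longrightarrow> y \<in> M \<Longrightarrow> x + y \<in> M"
    and "\<And>c x. x \<in> M \<Longrightarrow> c *\<^sub>C x \<in> M"
  shows "complex_vector.subspace M"
  using assms by (auto simp: complex_vector.subspace_def)

lemma real_subspace_of_complex_subspace: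
  "complex_vector.subspace (M::'a::complex_normed_vector set) \<Longrightarrow> subspace M"
  by (auto simp: complex_vector.subspace_def subspace_def scaleR_scaleC)


lemma cinner_add_left: "cinner (x + y) z = cinner x z + cinner y z"
  by (metis cinner_add_right cinner_commute complex_cnj_add)

lemma cinner_scaleC_left: "cinner (c *\<^sub>C x) y = cnj c * cinner x y"
  by (metis cinner_commute cinner_scaleC_right complex_cnj_mult)

lemma cinner_zero_right [simp]: "cinner x 0 = 0"
  using cinner_scaleC_right[of x 0 0] by (simp add: scaleC.zero_left)

lemma cinner_zero_left [simp]: "cinner 0 x = 0"
  by (metis cinner_zero_right cinner_commute complex_cnj_zero)

lemma cinner_minus_right: "cinner x (- y) = - cinner x y"
  by (metis add_eq_0_iff2 cinner_add_right cinner_zero_right add.commute ab_left_minus)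

lemma cinner_minus_left: "cinner (- x) y = - cinner x y"
  by (metis cinner_minus_right cinner_commute complex_cnj_minus)

lemma cinner_diff_right: "cinner x (y - z) = cinner x y - cinner x z"
  using cinner_add_right[of x y "-z"] by (simp add: cinner_minus_right)

lemma cinner_diff_left: "cinner (x - y) z = cinner x z - cinner y z"
  using cinner_add_left[of x "-y" z] by (simp add: cinner_minus_left)

lemma cinner_scaleR_right: "cinner x (r *\<^sub>R y) = of_real r * cinner x y"
  by (simp add: scaleR_scaleC cinner_scaleC_right)

lemma cinner_scaleR_left: "cinner (r *\<^sub>R x) y = of_real r * cinner x y"
  by (simp add: scaleR_scaleC cinner_scaleC_left)

lemma cinner_sum_right: "cinner x (sum f A) = (\<Sum>i\<in>A. cinner x (f i))"
  by (induct A rule: infinite_finite_induct) (simp_all add: cinner_add_right)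

lemma cinner_sum_left: "cinner (sum f A) x = (\<Sum>i\<in>A. cinner (f i) x)"
  by (induct A rule: infinite_finite_induct) (simp_all add: cinner_add_left)

lemmas cinner_simps = cinner_add_left cinner_add_right cinner_diff_left cinner_diff_right
  cinner_minus_left cinner_minus_right cinner_scaleC_left cinner_scaleC_right
  cinner_scaleR_left cinner_scaleR_right

lemma norm_sq_eq_Re_cinner: "(norm x)\<^sup>2 = Re (cinner x x)"
  by (simp add: cinner_norm)

lemma cinner_eq_zero_iff: "cinner x x = 0 \<longleftrightarrow> x = 0"
  by (simp add: cinner_norm)

lemma Re_cinner_commute: "Re (cinner x y) = Re (cinner y x)"
  by (metis cinner_commute complex_cnj(1) complex.sel(1) cnj.simps(1))

lemma norm_add_sq: "(norm (x + y))\<^sup>2 = (norm x)\<^sup>2 + 2 * Re (cinner x y) + (norm y)\<^sup>2"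
  using Re_cinner_commute[of x y] by (simp add: norm_sq_eq_Re_cinner cinner_simps)

lemma norm_diff_sq: "(norm (x - y))\<^sup>2 = (norm x)\<^sup>2 - 2 * Re (cinner x y) + (norm y)\<^sup>2"
  using Re_cinner_commute[of x y] by (simp add: norm_sq_eq_Re_cinner cinner_simps)

lemma Re_cinner_le: "Re (cinner x y) \<le> norm x * norm y"
proof (cases "x = 0 \<or> y = 0")
  case False
  have "0 \<le> (norm (norm y *\<^sub>R x - norm x *\<^sub>R y))\<^sup>2" by simp
  also have "\<dots> = 2 * (norm x * norm y) * (norm x * norm y - Re (cinner x y))"
    by (simp add: norm_diff_sq cinner_simps) (simp add: power2_eq_square algebra_simps)
  finally have "0 \<le> norm x * norm y - Re (cinner x y)"
    using False by (auto simp: zero_le_mult_iff mult_le_0_iff)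
  then show ?thesis by simp
qed auto

lemma norm_cinner_le: "norm (cinner x y) \<le> norm x * norm y"
proof (cases "cinner x y = 0")
  case False
  define c where "c = cnj (sgn (cinner x y))"
  have "norm (cinner x y) = Re (c * cinner x y)"
    unfolding c_def sgn_eq using False
    by (simp add: complex_mult_cnj mult.commute)
       (metis Re_complex_of_real complex_mult_cnj complex_norm_square mult.commute
         nonzero_mult_div_cancel_left norm_eq_zero of_real_eq_0_iff of_real_mult
         power2_eq_square times_divide_eq_right)
  also have "\<dots> = Re (cinner x (c *\<^sub>C y))"
    by (simp add: cinner_simps)
  also have "\<dots> \<le> norm x * (norm c * norm y)"
    using Re_cinner_le[of x "c *\<^sub>C y"] by (simp add: norm_scaleC)
  also have "norm c = 1"
    using False by (simp add: c_def norm_sgn)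
  finally show ?thesis by simp
qed simp

lemma bounded_bilinear_cinner:
  "bounded_bilinear (cinner :: 'a::chilbert_space \<Rightarrow> 'a \<Rightarrow> complex)"
proof
  show "\<exists>K. \<forall>a (b::'a). norm (cinner a b) \<le> norm a * norm b * K"
    by (rule exI[of _ 1]) (simp add: norm_cinner_le)
qed (simp_all add: cinner_simps scaleR_conv_of_real)

interpretation cinner: bounded_bilinear
  "cinner :: 'a::chilbert_space \<Rightarrow> 'a \<Rightarrow> complex"
  by (rule bounded_bilinear_cinner)

text \<open>Tuples form the Hilbert space direct sum: the \<open>\<ell>\<^sup>2\<close> norm of the component norms is the one given
  by the sum of the component inner products.\<close>

instantiation vec :: (chilbert_space, finite) chilbert_space
begin

definition scaleC_vec_def: "scaleC c x = (\<chi> i. c *\<^sub>C (x $ i))"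
definition cinner_vec_def: "cinner x y = (\<Sum>i\<in>UNIV. cinner (x $ i) (y $ i))"

instance
proof
  fix x y z :: "'a ^ 'b" and c d :: complex and r :: real
  show "r *\<^sub>R x = complex_of_real r *\<^sub>C x"
    by (simp add: vec_eq_iff scaleC_vec_def scaleR_scaleC)
  show "c *\<^sub>C (x + y) = c *\<^sub>C x + c *\<^sub>C y" "(c + d) *\<^sub>C x = c *\<^sub>C x + d *\<^sub>C x"
    "c *\<^sub>C (d *\<^sub>C x) = (c * d) *\<^sub>C x" "1 *\<^sub>C x = x"
    by (simp_all add: vec_eq_iff scaleC_vec_def scaleC_simps)
  show "norm (c *\<^sub>C x) = cmod c * norm x"
    by (simp add: norm_vec_def scaleC_vec_def norm_scaleC L2_set_right_distrib)
  show "cinner x y = cnj (cinner y x)"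
    unfolding cinner_vec_def cnj_sum by (rule sum.cong) (auto intro: cinner_commute)
  show "cinner x (y + z) = cinner x y + cinner x z"
    by (simp add: cinner_vec_def cinner_simps sum.distrib)
  show "cinner x (c *\<^sub>C y) = c * cinner x y"
    by (simp add: cinner_vec_def scaleC_vec_def cinner_simps sum_distrib_left)
  show "cinner x x = complex_of_real ((norm x)\<^sup>2)"
    by (simp add: cinner_vec_def cinner_norm norm_vec_def L2_set_def sum_nonneg)
qed

end

lemma scaleC_vec_nth [simp]: "(c *\<^sub>C x) $ i = c *\<^sub>C (x $ i)"
  by (simp add: scaleC_vec_def)

lemma bounded_clinearD:
  assumes "bounded_clinear f"
  shows "f (x + y) = f x + f y" "f (c *\<^sub>C x) = c *\<^sub>C f x" "bounded_linear f"
proof -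
  interpret f: Vector_Spaces.linear scaleC scaleC f
    using assms by (simp add: bounded_clinear_def)
  show 1: "f (x + y) = f x + f y" "f (c *\<^sub>C x) = c *\<^sub>C f x" for x y c
    by (rule f.add f.scale)+
  obtain K where "\<And>x. norm (f x) \<le> norm x * K"
    using assms by (auto simp: bounded_clinear_def)
  then show "bounded_linear f"
    by (intro bounded_linear_intro[of f K]) (simp_all add: 1 scaleR_scaleC)
qed

lemma bounded_clinearI:
  assumes "bounded_linear f" "\<And>c x. f (c *\<^sub>C x) = c *\<^sub>C f x"
  shows "bounded_clinear f"
proof -
  interpret f: bounded_linear f by fact
  show ?thesis
    unfolding bounded_clinear_def using f.bounded
    by (auto intro!: Vector_Spaces.linear.intro complex_vector.vector_space_axioms
        module_hom.intro module_hom_axioms.intro complex_vector.module_axioms simp: assms(2) f.add)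
       
qed

text \<open>A minimising sequence for the distance to a closed subspace is Cauchy by the
  parallelogram law; at the minimiser the first variation of the distance vanishes.\<close>

theorem orthogonal_projection:
  fixes L :: "'a::chilbert_space set"
  assumes L: "subspace L" "closed L"
  obtains m where "m \<in> L" "\<And>l. l \<in> L \<Longrightarrow> Re (cinner (x - m) l) = 0"
proof -
  have L0: "0 \<in> L" and Ladd: "\<And>u v. u \<in> L \<Longrightarrow> v \<in> L \<Longrightarrow> u + v \<in> L"
    and Lsc: "\<And>r u. u \<in> L \<Longrightarrow> r *\<^sub>R u \<in> L"
    using L(1) by (auto simp: subspace_def)
  define d where "d = Inf ((\<lambda>l. (norm (x - l))\<^sup>2) ` L)"
  have d_le: "d \<le> (norm (x - l))\<^sup>2" if "l \<in> L" for l
    unfolding d_def by (rule cInf_lower) (use that in \<open>auto intro!: bdd_belowI[of _ 0]\<close>)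
  have "\<exists>l\<in>L. (norm (x - l))\<^sup>2 < d + e" if "e > 0" for e
    using cInf_lessD[of "(\<lambda>l. (norm (x - l))\<^sup>2) ` L" "d + e"] L0 that by (auto simp: d_def)
  then have "\<forall>n. \<exists>l\<in>L. (norm (x - l))\<^sup>2 < d + inverse (Suc n)"
    by simp
  then obtain f where f: "\<And>n. f n \<in> L" "\<And>n. (norm (x - f n))\<^sup>2 < d + inverse (Suc n)"
    by metis
  have parallelogram: "(norm (f m - f n))\<^sup>2 \<le> 2 * (inverse (Suc m) + inverse (Suc n))" for m n
  proof -
    have "(1/2) *\<^sub>R (f m + f n) \<in> L" by (intro Lsc Ladd f)
    then have "d \<le> (norm (x - (1/2) *\<^sub>R (f m + f n)))\<^sup>2" by (rule d_le)
    also have "x - (1/2) *\<^sub>R (f m + f n) = (1/2) *\<^sub>R ((x - f m) + (x - f n))"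
      by (simp add: algebra_simps flip: scaleR_add_left)
    finally have "4 * d \<le> (norm ((x - f m) + (x - f n)))\<^sup>2"
      by (simp add: power_divide)
    moreover have "(norm ((x - f m) + (x - f n)))\<^sup>2 + (norm ((x - f m) - (x - f n)))\<^sup>2
        = 2 * (norm (x - f m))\<^sup>2 + 2 * (norm (x - f n))\<^sup>2"
      unfolding norm_add_sq norm_diff_sq[of "x - f m"] by simp
    moreover have "norm ((x - f m) - (x - f n)) = norm (f m - f n)"
      by (simp add: norm_minus_commute)
    ultimately show ?thesis using f(2)[of m] f(2)[of n] by simp
  qed
  have "Cauchy f"
  proof (rule metric_CauchyI)
    fix e :: real assume "e > 0"
    then obtain N where N: "inverse (real (Suc N)) < e\<^sup>2 / 4"
      using reals_Archimedean[of "e\<^sup>2 / 4"] by auto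
    show "\<exists>M. \<forall>m\<ge>M. \<forall>n\<ge>M. dist (f m) (f n) < e"
    proof (intro exI allI impI)
      fix m n assume "N \<le> m" "N \<le> n"
      then have "inverse (real (Suc m)) \<le> inverse (real (Suc N))"
        "inverse (real (Suc n)) \<le> inverse (real (Suc N))" by (auto intro!: le_imp_inverse_le)
      moreover have "2 * (a + b) \<le> 4 * c" if "a \<le> c" "b \<le> c" for a b c :: real
        using that by simp
      ultimately have "2 * (inverse (real (Suc m)) + inverse (real (Suc n)))
          \<le> 4 * inverse (real (Suc N))" by blast
      also have "\<dots> < e\<^sup>2" using N by simp
      finally have "(norm (f m - f n))\<^sup>2 < e\<^sup>2"
        by (rule le_less_trans[OF parallelogram])
      then show "dist (f m) (f n) < e"
        using \<open>e > 0\<close> by (simp add: dist_norm power_less_imp_less_base)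
    qed
  qed
  then obtain m where m: "f \<longlonglongrightarrow> m" using Cauchy_convergent convergent_def by blast
  have mL: "m \<in> L" using L(2) f(1) m closed_sequentially by blast
  have "(\<lambda>n. (norm (x - f n))\<^sup>2) \<longlonglongrightarrow> (norm (x - m))\<^sup>2"
    by (intro tendsto_intros m)
  moreover have "(\<lambda>n. d + inverse (Suc n)) \<longlonglongrightarrow> d + 0"
    by (intro tendsto_intros LIMSEQ_inverse_real_of_nat)
  ultimately have min: "(norm (x - m))\<^sup>2 \<le> d"
    using LIMSEQ_le[of "\<lambda>n. (norm (x - f n))\<^sup>2" _ "\<lambda>n. d + inverse (Suc n)"] f(2)
    by (force intro: less_imp_le)
  have "Re (cinner (x - m) l) = 0" if l: "l \<in> L" for l
  proof (cases "l = 0")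
    case False
    \<comment> \<open>The minimum over the line \<open>m + t l\<close> of the quadratic polynomial
      \<open>|x - m - t l|^2\<close> in \<open>t\<close> is attained at this \<open>t\<close>.\<close>
    define c where "c = Re (cinner (x - m) l)"
    define t where "t = c / (norm l)\<^sup>2"
    have "(norm (x - m))\<^sup>2 \<le> (norm (x - (m + t *\<^sub>R l)))\<^sup>2"
      using min d_le[OF Ladd[OF mL Lsc[OF l]], of t] by linarith
    also have "x - (m + t *\<^sub>R l) = (x - m) - t *\<^sub>R l" by simp
    also have "(norm ((x - m) - t *\<^sub>R l))\<^sup>2 = (norm (x - m))\<^sup>2 - 2 * (t * c) + t\<^sup>2 * (norm l)\<^sup>2"
      unfolding norm_diff_sq[of "x - m"] by (simp add: c_def cinner_scaleR_right power_mult_distrib)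
    also have "\<dots> = (norm (x - m))\<^sup>2 - c\<^sup>2 / (norm l)\<^sup>2"
      using False by (simp add: t_def power2_eq_square)
    finally show ?thesis
      using False by (simp add: divide_le_0_iff c_def)
  qed simp
  then show ?thesis using that mL by blast
qed

corollary complex_orthogonal_projection:
  fixes L :: "'a::chilbert_space set"
  assumes L: "complex_vector.subspace L" "closed L"
  obtains m where "m \<in> L" "\<And>l. l \<in> L \<Longrightarrow> cinner (x - m) l = 0"
proof -
  obtain m where m: "m \<in> L" "\<And>l. l \<in> L \<Longrightarrow> Re (cinner (x - m) l) = 0"
    using orthogonal_projection[OF real_subspace_of_complex_subspace[OF L(1)] L(2), of x] by blast
  have "cinner (x - m) l = 0" if "l \<in> L" for l
  proof (rule complex_eqI)
    have "\<i> *\<^sub>C l \<in> L" using L(1) that by (auto simp: complex_vector.subspace_def)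
    from m(2)[OF this] show "Im (cinner (x - m) l) = Im 0" by (simp add: cinner_simps)
  qed (use m(2) that in simp)
  then show ?thesis using that m(1) by blast
qed


section \<open>Square roots and inverses in Banach algebras\<close>

text \<open>The fixed point equation \<open>y = (s + y\<^sup>2) / 2\<close> says that \<open>(1 - y)\<^sup>2 = 1 - s\<close>, so this is
  the square root of \<open>1 - s\<close> without a unit. Starting the iteration at \<open>0\<close>, all iterates commute,
  and \<open>z\<^bsub>k+1\<^esub> - z\<^bsub>k\<^esub> = (z\<^bsub>k\<^esub> - z\<^bsub>k-1\<^esub>) (z\<^bsub>k\<^esub> + z\<^bsub>k-1\<^esub>) / 2\<close> shows that the increments are
  dominated by those of the same iteration for the number \<open>s = 1\<close>, which increases and stays
  below \<open>1\<close>. Every algebraic property that survives the iteration and limits passes to \<open>y\<close>; this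
  is the last conclusion.\<close>

theorem sqrt_iteration_limit:
  fixes prod :: "'a::banach \<Rightarrow> 'a \<Rightarrow> 'a"
  assumes "bounded_bilinear prod"
    and assoc: "\<And>x y z. prod (prod x y) z = prod x (prod y z)"
    and norm_prod: "\<And>x y. norm (prod x y) \<le> norm x * norm y"
    and s: "norm s \<le> 1"
  obtains y where "y = (1/2) *\<^sub>R (s + prod y y)" "norm y \<le> 1"
    "\<And>C. closed C \<Longrightarrow> 0 \<in> C \<Longrightarrow> (\<And>z. z \<in> C \<Longrightarrow> (1/2) *\<^sub>R (s + prod z z) \<in> C) \<Longrightarrow> y \<in> C"
proof -
  interpret bounded_bilinear prod by fact
  define f where "f = (\<lambda>z. (1/2) *\<^sub>R (s + prod z z))"
  define Y where "Y k = (f ^^ k) 0" for k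
  define r :: "nat \<Rightarrow> real" where "r k = ((\<lambda>t. (1 + t\<^sup>2) / 2) ^^ k) 0" for k
  have Y0: "Y 0 = 0" and YS: "Y (Suc k) = (1/2) *\<^sub>R (s + prod (Y k) (Y k))" for k
    by (simp_all add: Y_def f_def)
  have r0: "r 0 = 0" and rS: "r (Suc k) = (1 + (r k)\<^sup>2) / 2" for k
    by (simp_all add: r_def)
  have r_range: "0 \<le> r k \<and> r k \<le> 1" for k
  proof (induct k)
    case (Suc k)
    then have "(r k)\<^sup>2 \<le> 1" by (simp add: power_le_one)
    then show ?case by (simp add: rS)
  qed (simp add: r0)
  have r_mono: "r k \<le> r (Suc k)" for k
    using sum_squares_ge_zero[of "r k - 1" 0] by (simp add: rS power2_eq_square algebra_simps)
  have norm_Y: "norm (Y k) \<le> r k" for k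
  proof (induct k)
    case (Suc k)
    have "norm (prod (Y k) (Y k)) \<le> (r k)\<^sup>2"
      using norm_prod[of "Y k" "Y k"] mult_mono[OF Suc Suc] r_range[of k]
      by (simp add: power2_eq_square)
    then have "norm (s + prod (Y k) (Y k)) \<le> 1 + (r k)\<^sup>2"
      using s norm_triangle_ineq[of s "prod (Y k) (Y k)"] by linarith
    then show ?case by (simp add: YS rS)
  qed (simp add: Y0 r0)
  have comm_s: "prod s (Y k) = prod (Y k) s" for k
  proof (induct k)
    case (Suc k)
    have "prod s (prod (Y k) (Y k)) = prod (prod (Y k) (Y k)) s"
      by (metis Suc assoc)
    then show ?case by (simp add: YS add_left add_right scaleR_left scaleR_right)
  qed (simp add: Y0 zero_left zero_right)
  have comm: "prod (Y k) (Y l) = prod (Y l) (Y k)" for k l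
  proof (induct k)
    case (Suc k)
    have "prod (prod (Y k) (Y k)) (Y l) = prod (Y l) (prod (Y k) (Y k))"
      by (metis Suc assoc)
    then show ?case by (simp add: YS add_left add_right scaleR_left scaleR_right comm_s)
  qed (simp add: Y0 zero_left zero_right)
  have step: "norm (Y (Suc k) - Y k) \<le> r (Suc k) - r k" for k
  proof (induct k)
    case 0
    then show ?case using norm_Y[of "Suc 0"] by (simp add: Y0 r0)
  next
    case (Suc k)
    have "Y (Suc (Suc k)) - Y (Suc k)
        = (1/2) *\<^sub>R (prod (Y (Suc k)) (Y (Suc k)) - prod (Y k) (Y k))"
      unfolding YS[of "Suc k"] YS[of k] by (simp flip: scaleR_diff_right)
    also have "prod (Y (Suc k)) (Y (Suc k)) - prod (Y k) (Y k)
        = prod (Y (Suc k) - Y k) (Y (Suc k) + Y k)"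
      using comm[of "Suc k" k] by (simp add: add_left add_right diff_left diff_right)
    finally have "norm (Y (Suc (Suc k)) - Y (Suc k))
        \<le> (norm (Y (Suc k) - Y k) * norm (Y (Suc k) + Y k)) / 2"
      using norm_prod[of "Y (Suc k) - Y k" "Y (Suc k) + Y k"] by simp
    also have "\<dots> \<le> ((r (Suc k) - r k) * (r (Suc k) + r k)) / 2"
      using norm_triangle_le[of "Y (Suc k)" "Y k" "r (Suc k) + r k"] norm_Y[of k]
        norm_Y[of "Suc k"] r_mono[of k]
      by (intro divide_right_mono mult_mono Suc) auto
    also have "\<dots> = r (Suc (Suc k)) - r (Suc k)"
      by (simp add: rS power2_eq_square field_simps)
    finally show ?case .
  qed
  have "convergent r"
    using r_range incseq_SucI[of r, OF r_mono]
    by (intro Bseq_mono_convergent BseqI'[of _ 1]) (auto simp: incseq_def)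
  then have "summable (\<lambda>k. r (Suc k) - r k)"
    by (intro telescope_summable[OF convergent_LIMSEQ_iff[THEN iffD1]])
  then have "summable (\<lambda>k. Y (Suc k) - Y k)"
    using step by (rule summable_comparison_test')
  then have "convergent (\<lambda>n. \<Sum>k<n. Y (Suc k) - Y k)"
    by (simp add: summable_iff_convergent)
  then have "convergent Y"
    by (simp only: sum_lessThan_telescope Y0) simp
  then obtain y where y: "Y \<longlonglongrightarrow> y" by (auto simp: convergent_def)
  show ?thesis
  proof
    have "(\<lambda>k. Y (Suc k)) \<longlonglongrightarrow> (1/2) *\<^sub>R (s + prod y y)"
      unfolding YS by (intro tendsto_intros tendsto y)
    with LIMSEQ_Suc[OF y] show "y = (1/2) *\<^sub>R (s + prod y y)"
      by (rule LIMSEQ_unique)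
    show "norm y \<le> 1"
      using norm_Y r_range order_trans
      by (intro LIMSEQ_le_const2[OF tendsto_norm[OF y]]) blast
    fix C assume C: "closed C" "0 \<in> C" "\<And>z. z \<in> C \<Longrightarrow> (1/2) *\<^sub>R (s + prod z z) \<in> C"
    then have "Y k \<in> C" for k by (induct k) (simp_all add: Y0 YS)
    with C(1) y show "y \<in> C" using closed_sequentially by blast
  qed
qed

lemma neumann_inverse:
  fixes x :: "'a::{real_normed_algebra_1, complete_space}"
  assumes x: "norm x < 1"
  obtains y where "(1 - x) * y = 1" "y * (1 - x) = 1" "norm y \<le> 1 / (1 - norm x)"
proof -
  have "dist (1 + x * y) (1 + x * z) \<le> norm x * dist y z" for y z
    using norm_mult_ineq[of x "y - z"] by (simp add: dist_norm right_diff_distrib)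
  then have "\<exists>!y. 1 + x * y = y" using x by (intro banach_fix_type[of "norm x"]) auto
  moreover have "dist (1 + y * x) (1 + z * x) \<le> norm x * dist y z" for y z
    using norm_mult_ineq[of "y - z" x] by (simp add: dist_norm left_diff_distrib mult.commute)
  then have "\<exists>!y. 1 + y * x = y" using x by (intro banach_fix_type[of "norm x"]) auto
  ultimately
  obtain y z where y: "1 + x * y = y" and z: "1 + z * x = z" by blast
  have 1: "(1 - x) * y = 1" using y by (simp add: algebra_simps)
  have 2: "z * (1 - x) = 1" using z by (simp add: algebra_simps)
  have "z = y" by (metis 1 2 mult.assoc mult.left_neutral mult.right_neutral)
  moreover have "norm y \<le> 1 + norm x * norm y"
    using norm_triangle_ineq[of 1 "x * y"] norm_mult_ineq[of x y] y by simp
  then have "norm y \<le> 1 / (1 - norm x)" using x by (simp add: field_simps)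
  ultimately show ?thesis using 1 2 that by blast
qed

definition ring_inverse :: "'a::monoid_mult \<Rightarrow> 'a" where
  "ring_inverse a = (THE b. a * b = 1 \<and> b * a = 1)"

lemma ring_inverse_eq:
  assumes "a * b = 1" "b * a = 1"
  shows "ring_inverse a = b"
  unfolding ring_inverse_def
  by (rule the_equality) (use assms in \<open>auto, metis mult.assoc mult_1_left mult_1_right\<close>)

lemma ring_inverse_lipschitz:
  fixes a b :: "'a::real_normed_algebra_1"
  assumes a: "a' * a = 1" "norm a' \<le> C" and b: "b * b' = 1" "norm b' \<le> C"
  shows "norm (a' - b') \<le> C\<^sup>2 * norm (a - b)"
proof -
  have C: "0 \<le> C" using a(2) norm_ge_zero order_trans by blast
  have "a' - b' = - (a' * (a - b) * b')"
    using a(1) b(1) by (simp add: algebra_simps)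
  also have "norm \<dots> \<le> norm a' * norm (a - b) * norm b'"
    by (simp, rule order_trans[OF norm_mult_ineq mult_right_mono[OF norm_mult_ineq]]) simp
  also have "\<dots> \<le> C * norm (a - b) * C"
    using a(2) b(2) C by (intro mult_mono) auto
  finally show ?thesis by (simp add: power2_eq_square mult.commute mult.left_commute)
qed


section \<open>C*-algebras: the Cayley transform\<close>

lemma star_zero [simp]: "star (0::'a::unital_cstar_algebra) = 0"
  using star_scaleC[of 0 0] by (simp add: scaleC.zero_left)

lemma star_one [simp]: "star (1::'a::unital_cstar_algebra) = 1"
  by (metis mult_1_left mult_1_right star_mult star_star)

lemma star_minus: "star (- a) = - star (a::'a::unital_cstar_algebra)"
  by (metis add_eq_0_iff2 star_add star_zero add.commute ab_left_minus)

lemma star_diff: "star (a - b) = star a - star (b::'a::unital_cstar_algebra)"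
  using star_add[of a "-b"] by (simp add: star_minus)

lemma star_scaleR: "star (r *\<^sub>R a) = r *\<^sub>R star (a::'a::unital_cstar_algebra)"
  by (simp add: scaleR_scaleC star_scaleC)

lemmas star_simps = star_add star_diff star_minus star_scaleC star_scaleR star_mult star_star

lemma norm_star [simp]: "norm (star a) = norm (a::'a::unital_cstar_algebra)"
proof -
  have le: "norm b \<le> norm (star b)" for b :: 'a
  proof (cases "norm b = 0")
    case False
    have "(norm b)\<^sup>2 \<le> norm (star b) * norm b"
      by (metis norm_mult_ineq norm_star_mult_self)
    then show ?thesis using False by (simp add: power2_eq_square)
  qed simp
  from le[of a] le[of "star a"] show ?thesis by (simp add: star_star)
qed

lemma bounded_linear_star: "bounded_linear (star :: 'a::unital_cstar_algebra \<Rightarrow> 'a)"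
  by (rule bounded_linear_intro[where K = 1]) (simp_all add: star_simps)

lemma norm_unitary:
  assumes "u \<in> unitary_elements"
  shows "norm (u::'a::unital_cstar_algebra) = 1"
proof -
  have "star u * u = 1" using assms by (simp add: unitary_elements_def)
  then have "(norm u)\<^sup>2 = 1" using norm_star_mult_self[of u] by simp
  then show ?thesis using norm_ge_zero[of u] by (auto simp: power2_eq_1_iff)
qed

text \<open>If \<open>c = (1 - ih)\<^sup>-\<^sup>1\<close> exists, then \<open>2 c - 1 = (1 + ih) (1 - ih)\<^sup>-\<^sup>1\<close> is the Cayley transform
  of \<open>h\<close>. It is unitary, which bounds \<open>c\<close> uniformly in \<open>h\<close>.\<close>

lemma cayley_unitary:
  fixes h :: "'a::unital_cstar_algebra"
  assumes h: "star h = h" and c: "(1 - \<i> *\<^sub>C h) * c = 1" "c * (1 - \<i> *\<^sub>C h) = 1"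
  shows "2 * c - 1 \<in> unitary_elements" "norm c \<le> 1"
proof -
  define k where "k = \<i> *\<^sub>C h"
  have k: "star k = - k" by (simp add: k_def star_scaleC h scaleC.minus_left)
  have c1: "(1 - k) * c = 1" and c2: "c * (1 - k) = 1" using c by (simp_all add: k_def)
  have s1: "star c * (1 + k) = 1" and s2: "(1 + k) * star c = 1"
    using arg_cong[OF c1, of star] arg_cong[OF c2, of star] by (simp_all add: star_simps k)
  have kc: "k * c = c * k"
  proof -
    have "c - k * c = c - c * k" using c1 c2 by (simp add: left_diff_distrib right_diff_distrib)
    then show ?thesis by simp
  qed
  have u1: "2 * c - 1 = (1 + k) * c" and u2: "2 * c - 1 = c * (1 + k)"
    using c1 kc by (simp_all add: algebra_simps mult_2)
  have v1: "star (2 * c - 1) = star c * (1 - k)" and v2: "star (2 * c - 1) = (1 - k) * star c"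
    using arg_cong[OF u1, of star] arg_cong[OF u2, of star] by (simp_all add: star_simps k)
  have comm: "(1 - k) * (1 + k) = (1 + k) * (1 - k)" by (simp add: algebra_simps)
  have "star (2 * c - 1) * (2 * c - 1) = star c * ((1 - k) * (1 + k)) * c"
    unfolding v1 by (simp only: u1 mult.assoc)
  also have "\<dots> = (star c * (1 + k)) * ((1 - k) * c)" unfolding comm by (simp add: mult.assoc)
  also have "\<dots> = 1" by (simp add: c1 s1)
  finally have *: "star (2 * c - 1) * (2 * c - 1) = 1" .
  have "(2 * c - 1) * star (2 * c - 1) = c * ((1 + k) * (1 - k)) * star c"
    unfolding v2 by (simp only: u2 mult.assoc)
  also have "\<dots> = (c * (1 - k)) * ((1 + k) * star c)" unfolding comm[symmetric] by (simp add: mult.assoc)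
  also have "\<dots> = 1" by (simp add: c2 s2)
  finally show u: "2 * c - 1 \<in> unitary_elements" using * by (simp add: unitary_elements_def)
  have "2 *\<^sub>R c = 1 + (2 * c - 1)" by (simp add: scaleR_2 mult_2)
  from arg_cong[OF this, of norm] have "2 * norm c = norm (1 + (2 * c - 1))" by simp
  then show "norm c \<le> 1"
    using norm_triangle_ineq[of 1 "2 * c - 1"] norm_unitary[OF u] by simp
qed

text \<open>Since the inverses have norm at most \<open>1\<close>, the set of real \<open>t\<close> with \<open>1 - ith\<close> invertible
  contains with each point an interval of a fixed length around it; walking from \<open>t = 0\<close> in steps of
  that length reaches \<open>t = 1\<close>.\<close>

lemma cayley_resolvent_exists:
  fixes h :: "'a::unital_cstar_algebra"
  assumes h: "star h = h"
  shows "\<exists>c. (1 - \<i> *\<^sub>C h) * c = 1 \<and> c * (1 - \<i> *\<^sub>C h) = 1"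
proof -
  obtain N :: nat where N: "norm h < N" using reals_Archimedean2 by blast
  then have N0: "N > 0" by (metis norm_ge_zero not_less of_nat_0 gr0I)
  define g where "g = inverse N *\<^sub>R h"
  have g: "star g = g" "norm g < 1"
    using N N0 by (simp_all add: g_def star_scaleR h field_simps)
  have "\<exists>c. (1 - \<i> *\<^sub>C (real k *\<^sub>R g)) * c = 1 \<and> c * (1 - \<i> *\<^sub>C (real k *\<^sub>R g)) = 1" for k
  proof (induct k)
    case 0
    then show ?case by (simp add: scaleC.zero_right)
  next
    case (Suc k)
    define p where "p = 1 - \<i> *\<^sub>C (real k *\<^sub>R g)"
    obtain c where c: "p * c = 1" "c * p = 1" using Suc by (auto simp: p_def)
    have "norm c \<le> 1"
      by (rule cayley_unitary(2)[of "real k *\<^sub>R g"]) (use g c in \<open>simp_all add: star_scaleR p_def\<close>)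
    define x where "x = c * (\<i> *\<^sub>C g)"
    have "norm x \<le> norm c * norm g"
      unfolding x_def using norm_mult_ineq[of c "\<i> *\<^sub>C g"] by (simp add: norm_scaleC)
    then have "norm x < 1"
      using \<open>norm c \<le> 1\<close> g(2) mult_right_mono[of "norm c" 1 "norm g"] by simp
    then obtain y where y: "(1 - x) * y = 1" "y * (1 - x) = 1" by (rule neumann_inverse)
    have "1 - \<i> *\<^sub>C (real (Suc k) *\<^sub>R g) = p - (p * c) * (\<i> *\<^sub>C g)"
      unfolding p_def c[unfolded p_def]
      by (simp add: scaleR_left_distrib scaleC_simps)
    also have "\<dots> = p * (1 - x)" by (simp add: x_def right_diff_distrib mult.assoc)
    finally have eq: "1 - \<i> *\<^sub>C (real (Suc k) *\<^sub>R g) = p * (1 - x)" .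
    have "(p * (1 - x)) * (y * c) = p * ((1 - x) * y) * c" by (simp only: mult.assoc)
    moreover have "(y * c) * (p * (1 - x)) = y * (c * p) * (1 - x)" by (simp only: mult.assoc)
    ultimately show ?case unfolding eq using c y by (intro exI[of _ "y * c"]) simp
  qed
  from this[of N] show ?thesis using N0 by (simp add: g_def)
qed

definition cayley_resolvent :: "'a::unital_cstar_algebra \<Rightarrow> 'a" where
  "cayley_resolvent h = ring_inverse (1 - \<i> *\<^sub>C h)"

lemma cayley_resolvent:
  fixes h :: "'a::unital_cstar_algebra"
  assumes h: "star h = h"
  shows "(1 - \<i> *\<^sub>C h) * cayley_resolvent h = 1" "cayley_resolvent h * (1 - \<i> *\<^sub>C h) = 1"
    and "norm (cayley_resolvent h) \<le> 1"
    and "2 * cayley_resolvent h - 1 \<in> unitary_elements"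
proof -
  obtain c where "(1 - \<i> *\<^sub>C h) * c = 1" "c * (1 - \<i> *\<^sub>C h) = 1"
    using cayley_resolvent_exists[OF h] by blast
  moreover from this have "cayley_resolvent h = c"
    unfolding cayley_resolvent_def by (rule ring_inverse_eq)
  ultimately show *: "(1 - \<i> *\<^sub>C h) * cayley_resolvent h = 1"
    "cayley_resolvent h * (1 - \<i> *\<^sub>C h) = 1" by simp_all
  show "norm (cayley_resolvent h) \<le> 1" "2 * cayley_resolvent h - 1 \<in> unitary_elements"
    using cayley_unitary[OF h *] by blast+
qed

lemma continuous_on_cayley_resolvent:
  "continuous_on {h::'a::unital_cstar_algebra. star h = h} cayley_resolvent"
proof (rule continuous_on_iff[THEN iffD2], intro ballI allI impI)
  fix h :: 'a and e :: real assume h: "h \<in> {h. star h = h}" and "0 < e"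
  have "dist (cayley_resolvent h') (cayley_resolvent h) \<le> dist h' h" if "star h' = h'" for h'
    using ring_inverse_lipschitz[of "cayley_resolvent h'" "1 - \<i> *\<^sub>C h'" 1
        "1 - \<i> *\<^sub>C h" "cayley_resolvent h"] cayley_resolvent[OF that] cayley_resolvent[of h] h
      norm_scaleC[of \<i> "h - h'"]
    by (simp add: dist_norm scaleC.diff_right norm_minus_commute)
  then show "\<exists>d>0. \<forall>h'\<in>{h. star h = h}. dist h' h < d \<longrightarrow>
      dist (cayley_resolvent h') (cayley_resolvent h) < e"
    using \<open>0 < e\<close> by (intro exI[of _ e]) (auto intro: le_less_trans)
qed


section \<open>Representations and Schur's lemma\<close>

locale star_rep =
  fixes \<pi> :: "'a::unital_cstar_algebra \<Rightarrow> 'h::chilbert_space \<Rightarrow> 'h"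
  assumes star_representation: "star_representation \<pi>"
begin

lemma rep_bounded_clinear: "bounded_clinear (\<pi> a)"
  and rep_add_left: "\<pi> (a + b) v = \<pi> a v + \<pi> b v"
  and rep_scaleC_left: "\<pi> (c *\<^sub>C a) v = c *\<^sub>C \<pi> a v"
  and rep_mult: "\<pi> (a * b) v = \<pi> a (\<pi> b v)"
  and rep_adjoint: "cinner (\<pi> a u) v = cinner u (\<pi> (star a) v)"
  using star_representation by (simp_all add: star_representation_def is_cadjoint_def)

lemma rep_add_right: "\<pi> a (u + v) = \<pi> a u + \<pi> a v"
  and rep_scaleC_right: "\<pi> a (c *\<^sub>C v) = c *\<^sub>C \<pi> a v"
  and rep_bounded_linear: "bounded_linear (\<pi> a)"
  by (rule bounded_clinearD[OF rep_bounded_clinear])+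

lemma rep_zero_right [simp]: "\<pi> a 0 = 0"
  and rep_diff_right: "\<pi> a (u - v) = \<pi> a u - \<pi> a v"
  and rep_scaleR_right: "\<pi> a (r *\<^sub>R v) = r *\<^sub>R \<pi> a v"
  using linear_simps[OF rep_bounded_linear] by auto

lemma rep_scaleR_left: "\<pi> (r *\<^sub>R a) v = r *\<^sub>R \<pi> a v"
  by (simp add: scaleR_scaleC rep_scaleC_left)

lemma rep_zero_left [simp]: "\<pi> 0 v = 0"
  using rep_scaleR_left[of 0 0] by simp

lemma rep_diff_left: "\<pi> (a - b) v = \<pi> a v - \<pi> b v"
  using rep_add_left[of "a - b" b v] by simp

end

locale irreducible_rep = star_rep \<pi>
  for \<pi> :: "'a::unital_cstar_algebra \<Rightarrow> 'h::chilbert_space \<Rightarrow> 'h" +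
  assumes irreducible: "irreducible_representation \<pi>" and nonzero: "nonzero_representation \<pi>"
begin

lemma invariant_subspace_trivial:
  assumes "complex_vector.subspace M" "closed M" "\<And>a v. v \<in> M \<Longrightarrow> \<pi> a v \<in> M"
  shows "M = {0} \<or> M = UNIV"
  using irreducible assms unfolding irreducible_representation_def by (metis image_subsetI)

lemma rep_one [simp]: "\<pi> 1 v = v"
proof -
  define M where "M = {v. \<pi> 1 v = v}"
  have "closed M"
    unfolding M_def
    by (intro closed_Collect_eq linear_continuous_on rep_bounded_linear continuous_on_id)
  moreover have "complex_vector.subspace M"
    by (rule complex_subspaceI) (simp_all add: M_def rep_add_right rep_scaleC_right)
  moreover have in_M: "\<pi> a u \<in> M" for a u
    by (simp add: M_def flip: rep_mult)
  ultimately have "M = {0} \<or> M = UNIV" by (intro invariant_subspace_trivial)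
  moreover have "M \<noteq> {0}" using nonzero in_M by (auto simp: nonzero_representation_def)
  ultimately show ?thesis by (auto simp: M_def)
qed

lemma rep_sandwich: "Re (cinner v (\<pi> (star a * a) v)) = (norm (\<pi> a v))\<^sup>2"
  by (simp add: rep_mult norm_sq_eq_Re_cinner rep_adjoint star_star)

text \<open>For \<open>\<parallel>a\<parallel> \<le> 1\<close> the element \<open>1 - a\<^sup>*a\<close> is the square of a self-adjoint element, hence is mapped
  to a positive operator.\<close>

lemma norm_rep_le: "norm (\<pi> a v) \<le> norm a * norm v"
proof (cases "a = 0")
  case False
  define b where "b = inverse (norm a) *\<^sub>R a"
  have b: "norm b = 1" using False by (simp add: b_def)
  obtain y where y: "y = (1/2) *\<^sub>R (star b * b + y * y)" and closed: "\<And>C. closed C \<Longrightarrow> 0 \<in> C \<Longrightarrow>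
      (\<And>z. z \<in> C \<Longrightarrow> (1/2) *\<^sub>R (star b * b + z * z) \<in> C) \<Longrightarrow> y \<in> C"
    by (rule sqrt_iteration_limit[OF bounded_bilinear_mult, of "star b * b"])
      (auto simp: mult.assoc norm_mult_ineq norm_star_mult_self b)
  have "y \<in> {z. star z = z}"
    by (rule closed) (auto intro!: closed_Collect_eq linear_continuous_on bounded_linear_star
        continuous_on_id simp: star_simps)
  then have y_star: "star (1 - y) = 1 - y" by (simp add: star_simps)
  have "2 *\<^sub>R y = star b * b + y * y" by (subst y) simp
  then have sq: "star b * b = 1 - star (1 - y) * (1 - y)"
    unfolding y_star by (simp add: algebra_simps scaleR_2)
  have "(norm (\<pi> b v))\<^sup>2 = (norm v)\<^sup>2 - (norm (\<pi> (1 - y) v))\<^sup>2"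
    unfolding rep_sandwich[symmetric] sq
    by (simp only: rep_diff_left cinner_diff_right rep_one minus_complex.sel norm_sq_eq_Re_cinner)
  then have "(norm (\<pi> b v))\<^sup>2 \<le> (norm v)\<^sup>2" by simp
  then have "norm (\<pi> b v) \<le> norm v" by (rule power2_le_imp_le) simp
  then show ?thesis using False by (simp add: b_def rep_scaleR_left field_simps)
qed simp

lemma rep_bounded_bilinear: "bounded_bilinear \<pi>"
proof
  show "\<exists>K. \<forall>a v. norm (\<pi> a v) \<le> norm a * norm v * K"
    by (rule exI[of _ 1]) (simp add: norm_rep_le)
qed (simp_all add: rep_add_left rep_add_right rep_scaleR_left rep_scaleR_right)

lemma commutant_kernel:
  assumes T: "bounded_clinear T" "\<And>a v. T (\<pi> a v) = \<pi> a (T v)" and x: "T x = 0" "x \<noteq> 0"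
  shows "T v = 0"
proof -
  note T' = bounded_clinearD[OF T(1)]
  have "closed {v. T v = 0}"
    by (intro closed_Collect_eq linear_continuous_on T'(3) continuous_on_const)
  moreover have "complex_vector.subspace {v. T v = 0}"
    by (rule complex_subspaceI) (simp_all add: T' linear_simps[OF T'(3)] scaleC.zero_right)
  ultimately have "{v. T v = 0} = {0} \<or> {v. T v = 0} = UNIV"
    by (intro invariant_subspace_trivial) (simp_all add: T(2))
  then show ?thesis using x by blast
qed

text \<open>Subtracting a multiple of the identity makes one diagonal coefficient \<open>\<langle>x, Tx\<rangle>\<close> vanish. With
  \<open>R = (T\<^sup>2)\<^bsup>1/2\<^esup>\<close> one has \<open>(R + T) (R - T) = 0\<close>, so \<open>R = T\<close> or \<open>R + T\<close> has a nonzero kernel, hence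
  vanishes by irreducibility. In both cases the vanishing coefficient of a positive operator
  forces \<open>Tx = 0\<close>, and irreducibility gives \<open>T = 0\<close>.\<close>

lemma schur_selfadjoint:
  assumes T: "bounded_clinear T" and sa: "\<And>u v. cinner (T u) v = cinner u (T v)"
    and comm: "\<And>a v. T (\<pi> a v) = \<pi> a (T v)"
  shows "\<exists>r::real. \<forall>v. T v = r *\<^sub>R v"
proof -
  note T' = bounded_clinearD[OF T]
  obtain x :: 'h where x: "x \<noteq> 0"
    using nonzero by (auto simp: nonzero_representation_def)
  define r where "r = Re (cinner x (T x)) / (norm x)\<^sup>2"
  define S where "S v = T v - r *\<^sub>R v" for v
  have S: "bounded_clinear S"
    unfolding S_def
    by (intro bounded_clinearI bounded_linear_sub T'(3) bounded_linear_scaleR_right)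
      (simp add: T' scaleR_scaleC_commute scaleC.diff_right)
  have S_sa: "cinner (S u) v = cinner u (S v)" for u v
    by (simp add: S_def cinner_simps sa)
  have S_comm: "S (\<pi> a v) = \<pi> a (S v)" for a v
    by (simp add: S_def comm rep_diff_right rep_scaleR_right)
  have S_x: "Re (cinner x (S x)) = 0"
    using x by (simp add: S_def cinner_simps r_def flip: norm_sq_eq_Re_cinner)
  note S' = bounded_clinearD[OF S]
  have "S v = 0" for v
  proof (cases "onorm S = 0")
    case True
    then show ?thesis using onorm[OF S'(3), of v] by simp
  next
    case False
    define n where "n = onorm S"
    have n: "n > 0" using False onorm_pos_le[OF S'(3)] by (simp add: n_def)
    define B where "B = Blinfun (\<lambda>v. inverse n *\<^sub>R S v)"
    have B: "blinfun_apply B v = inverse n *\<^sub>R S v" for v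
      unfolding B_def by (subst bounded_linear_Blinfun_apply)
        (auto intro: bounded_linear_const_scaleR S'(3))
    have B_clin: "blinfun_apply B (c *\<^sub>C v) = c *\<^sub>C blinfun_apply B v" for c v
      by (simp add: B S' scaleR_scaleC_commute)
    have B_sa: "cinner (blinfun_apply B u) v = cinner u (blinfun_apply B v)" for u v
      by (simp add: B cinner_simps S_sa)
    have B_comm: "blinfun_apply B (\<pi> a v) = \<pi> a (blinfun_apply B v)" for a v
      by (simp add: B S_comm rep_scaleR_right)
    have B_le: "norm (blinfun_apply B v) \<le> norm v" for v
      using onorm[OF S'(3), of v] n by (simp add: B n_def[symmetric] field_simps)
    define s where "s = id_blinfun - (B o\<^sub>L B)"
    have s: "blinfun_apply s v = v - blinfun_apply B (blinfun_apply B v)" for v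
      by (simp add: s_def blinfun.diff_left)
    have "norm s \<le> 1"
    proof (rule norm_blinfun_bound)
      fix v
      have "(norm (blinfun_apply s v))\<^sup>2
          = (norm v)\<^sup>2 - 2 * (norm (blinfun_apply B v))\<^sup>2 + (norm (blinfun_apply B (blinfun_apply B v)))\<^sup>2"
        unfolding s norm_diff_sq by (simp add: norm_sq_eq_Re_cinner flip: B_sa)
      also have "\<dots> \<le> (norm v)\<^sup>2"
        using power_mono[OF B_le[of "blinfun_apply B v"] norm_ge_zero, of 2]
          zero_le_power2[of "norm (blinfun_apply B v)"] by linarith
      finally have "norm (blinfun_apply s v) \<le> norm v" by (rule power2_le_imp_le) simp
      then show "norm (blinfun_apply s v) \<le> 1 * norm v" by simp
    qed simp
    obtain y where y: "y = (1/2) *\<^sub>R (s + (y o\<^sub>L y))" "norm y \<le> 1"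
      and closed: "\<And>C. closed C \<Longrightarrow> 0 \<in> C \<Longrightarrow>
        (\<And>z. z \<in> C \<Longrightarrow> (1/2) *\<^sub>R (s + (z o\<^sub>L z)) \<in> C) \<Longrightarrow> y \<in> C"
      by (rule sqrt_iteration_limit[OF bounded_bilinear_blinfun_compose, of s])
        (auto intro: blinfun_eqI simp: norm_blinfun_compose \<open>norm s \<le> 1\<close>)
    have y_comm: "blinfun_apply y (G v) = G (blinfun_apply y v)"
      if G: "bounded_linear G" "\<And>v. blinfun_apply s (G v) = G (blinfun_apply s v)" for G v
    proof -
      have "y \<in> {z. \<forall>v. blinfun_apply z (G v) = G (blinfun_apply z v)}"
      proof (rule closed)
        show "closed {z. \<forall>v. blinfun_apply z (G v) = G (blinfun_apply z v)}"
          by (intro closed_Collect_all closed_Collect_eq bounded_linear.continuous_on[OF G(1)]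
              continuous_intros)
      qed (simp_all add: blinfun.bilinear_simps linear_simps[OF G(1)] G(2))
      then show ?thesis by blast
    qed
    define R where "R v = v - blinfun_apply y v" for v
    have R_sq: "R (R v) = blinfun_apply B (blinfun_apply B v)" for v
    proof -
      have "2 *\<^sub>R blinfun_apply y v = blinfun_apply s v + blinfun_apply y (blinfun_apply y v)"
        by (subst y(1)) (simp add: blinfun.bilinear_simps)
      then show ?thesis
        by (simp add: R_def s blinfun.bilinear_simps scaleR_2 algebra_simps)
    qed
    have R_B: "R (blinfun_apply B v) = blinfun_apply B (R v)" for v
      using y_comm[of "blinfun_apply B" v]
      by (simp add: R_def s blinfun.bilinear_simps blinfun.bounded_linear_right)
    have R_pi: "R (\<pi> a v) = \<pi> a (R v)" for a v
      using y_comm[of "\<pi> a" v] by (simp add: R_def s rep_diff_right rep_bounded_linear B_comm)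
    have R_clin: "R (c *\<^sub>C v) = c *\<^sub>C R v" for c v
      using y_comm[of "scaleC c" v]
      by (simp add: R_def s scaleC.diff_right scaleC.bounded_linear_right B_clin)
    have R: "bounded_linear R"
      unfolding R_def by (intro bounded_linear_sub bounded_linear_ident blinfun.bounded_linear_right)
    have add: "bounded_clinear (\<lambda>v. R v + blinfun_apply B v)"
      by (intro bounded_clinearI bounded_linear_add R blinfun.bounded_linear_right)
        (simp add: R_clin B_clin scaleC_add_right)
    have "(\<forall>v. blinfun_apply B v = R v) \<or> (\<forall>v. blinfun_apply B v = - R v)"
    proof (cases "\<forall>v. R v - blinfun_apply B v = 0")
      case False
      then obtain u where u: "R u - blinfun_apply B u \<noteq> 0" by blast
      have "R (R u - blinfun_apply B u) + blinfun_apply B (R u - blinfun_apply B u) = 0"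
        by (simp add: linear_simps[OF R] blinfun.diff_right R_sq R_B)
      moreover have "R (\<pi> a v) + blinfun_apply B (\<pi> a v) = \<pi> a (R v + blinfun_apply B v)" for a v
        by (simp add: R_pi B_comm rep_add_right)
      ultimately have "R v + blinfun_apply B v = 0" for v
        using commutant_kernel[OF add _ _ u] by blast
      then show ?thesis by (simp add: eq_neg_iff_add_eq_0 add.commute)
    qed simp
    moreover have "Re (cinner x (blinfun_apply B x)) = 0"
      by (simp add: B cinner_simps S_x)
    ultimately have "Re (cinner x (R x)) = 0" by (auto simp: cinner_simps)
    then have "Re (cinner x (blinfun_apply y x)) = (norm x)\<^sup>2"
      by (simp add: R_def cinner_simps norm_sq_eq_Re_cinner)
    moreover have "norm (blinfun_apply y x) \<le> norm x"
      using norm_blinfun[of y x] mult_right_mono[OF y(2), of "norm x"] by simp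
    ultimately have "(norm (R x))\<^sup>2 \<le> 0"
      unfolding R_def norm_diff_sq using power_mono[of "norm (blinfun_apply y x)" "norm x" 2] by simp
    then have "R x = 0" by simp
    with \<open>(\<forall>v. blinfun_apply B v = R v) \<or> (\<forall>v. blinfun_apply B v = - R v)\<close>
    have "blinfun_apply B x = 0" by auto
    then have "S x = 0" using n by (simp add: B)
    then show ?thesis using commutant_kernel[OF S S_comm _ x] by blast
  qed
  then have "T v = r *\<^sub>R v" for v by (simp add: S_def)
  then show ?thesis by blast
qed

text \<open>The general case by decomposition into self-adjoint parts.\<close>

corollary schur:
  assumes T: "bounded_clinear T" "bounded_clinear T'"
    and adj: "\<And>u v. cinner (T u) v = cinner u (T' v)"
    and comm: "\<And>a v. T (\<pi> a v) = \<pi> a (T v)" "\<And>a v. T' (\<pi> a v) = \<pi> a (T' v)"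
  shows "\<exists>c::complex. \<forall>v. T v = c *\<^sub>C v"
proof -
  note T' = bounded_clinearD[OF T(1)] bounded_clinearD[OF T(2)]
  have adj': "cinner (T' u) v = cinner u (T v)" for u v
    by (metis adj cinner_commute)
  have "bounded_clinear (\<lambda>v. T v + T' v)"
    by (intro bounded_clinearI bounded_linear_add T'(3,6)) (simp add: T' scaleC_add_right)
  then obtain r where r: "\<And>v. T v + T' v = r *\<^sub>R v"
    using schur_selfadjoint[of "\<lambda>v. T v + T' v"]
    by (auto simp: cinner_simps adj adj' comm rep_add_right add.commute)
  have "bounded_clinear (\<lambda>v. \<i> *\<^sub>C (T v - T' v))"
    by (intro bounded_clinearI bounded_linear_compose[OF scaleC.bounded_linear_right]
        bounded_linear_sub T'(3,6))
      (simp add: T' scaleC_scaleC scaleC.diff_right mult.commute)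
  then obtain q where q: "\<And>v. \<i> *\<^sub>C (T v - T' v) = q *\<^sub>R v"
    using schur_selfadjoint[of "\<lambda>v. \<i> *\<^sub>C (T v - T' v)"]
    by (auto simp: cinner_simps adj adj' comm rep_diff_right rep_scaleC_right algebra_simps)
  have "T v = ((r - \<i> * q) / 2) *\<^sub>C v" for v
  proof -
    have "T v - T' v = (- \<i>) *\<^sub>C (\<i> *\<^sub>C (T v - T' v))" by (simp add: scaleC_scaleC scaleC_one)
    also have "\<dots> = (- \<i> * q) *\<^sub>C v" unfolding q by (simp only: scaleR_scaleC scaleC_scaleC)
    finally have diff: "T v - T' v = (- \<i> * q) *\<^sub>C v" .
    have "2 *\<^sub>R T v = (T v + T' v) + (T v - T' v)" by (simp add: scaleR_2)
    also have "\<dots> = of_real r *\<^sub>C v + (- \<i> * q) *\<^sub>C v" by (simp only: r diff scaleR_scaleC)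
    also have "\<dots> = (r - \<i> * q) *\<^sub>C v" by (simp add: scaleC.minus_left scaleC.diff_left)
    finally have "(1/2) *\<^sub>R (2 *\<^sub>R T v) = (1/2) *\<^sub>R ((r - \<i> * q) *\<^sub>C v)" by simp
    then show ?thesis by (simp add: scaleR_scaleC scaleC_scaleC)
  qed
  then show ?thesis by blast
qed

end


section \<open>The density theorem for irreducible representations\<close>

definition amplify :: "('h \<Rightarrow> 'h) \<Rightarrow> 'h ^ 'm \<Rightarrow> 'h ^ 'm" where
  "amplify f v = (\<chi> i. f (v $ i))"

lemma amplify_nth [simp]: "amplify f v $ i = f (v $ i)"
  by (simp add: amplify_def)

lemma bounded_linear_amplify:
  fixes f :: "'h::real_normed_vector \<Rightarrow> 'h"
  assumes "bounded_linear f"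
  shows "bounded_linear (amplify f :: 'h ^ 'm::finite \<Rightarrow> 'h ^ 'm)"
proof -
  interpret f: bounded_linear f by fact
  show ?thesis
  proof (rule bounded_linear_intro)
    show "norm (amplify f v) \<le> norm v * (real CARD('m) * onorm f)" for v :: "'h ^ 'm"
    proof -
      have "norm (amplify f v) \<le> (\<Sum>i\<in>UNIV. norm (f (v $ i)))"
        unfolding norm_vec_def by (rule order_trans[OF L2_set_le_sum]) simp_all
      also have "\<dots> \<le> (\<Sum>i\<in>(UNIV::'m set). onorm f * norm v)"
        by (intro sum_mono order_trans[OF onorm[OF assms]] mult_left_mono Finite_Cartesian_Product.norm_nth_le
            onorm_pos_le assms)
      finally show ?thesis by (simp add: mult_ac)
    qed
  qed (simp_all add: vec_eq_iff f.add f.scaleR)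
qed

lemma closure_add:
  fixes M :: "'a::real_normed_vector set"
  assumes "\<And>x y. x \<in> M \<Longrightarrow> y \<in> M \<Longrightarrow> x + y \<in> M" "x \<in> closure M" "y \<in> closure M"
  shows "x + y \<in> closure M"
proof -
  obtain f g where "\<And>n. f n \<in> M" "f \<longlonglongrightarrow> x" "\<And>n. g n \<in> M" "g \<longlonglongrightarrow> y"
    using assms(2,3) unfolding closure_sequential by blast
  then show ?thesis
    unfolding closure_sequential using assms(1) tendsto_add[of f x _ g y]
    by (intro exI[of _ "\<lambda>n. f n + g n"]) simp
qed

lemma closure_bounded_linear:
  assumes "bounded_linear f" "f ` M \<subseteq> M" "x \<in> closure M"
  shows "f x \<in> closure M"
  using closure_bounded_linear_image_subset[OF assms(1), of M] closure_mono[OF assms(2)] assms(3)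
  by blast

lemma complex_subspace_closure:
  fixes M :: "'a::complex_normed_vector set"
  assumes M: "complex_vector.subspace M"
  shows "complex_vector.subspace (closure M)"
  using M closure_subset[of M]
  by (intro complex_subspaceI closure_add closure_bounded_linear[OF scaleC.bounded_linear_right])
    (auto simp: complex_vector.subspace_def)

lemma real_subspace_closure:
  fixes M :: "'a::real_normed_vector set"
  assumes M: "subspace M"
  shows "subspace (closure M)"
  unfolding subspace_def using M closure_subset[of M]
  by (auto simp: subspace_def intro!: closure_add closure_bounded_linear[OF bounded_linear_scaleR_right])

context irreducible_rep
begin

lemma cinner_amplify_rep:
  "cinner (amplify (\<pi> a) u) v = cinner u (amplify (\<pi> (star a)) v)"
  by (simp add: cinner_vec_def rep_adjoint)

lemma amplify_rep_simps:
  "amplify (\<pi> a) (u + v) = amplify (\<pi> a) u + amplify (\<pi> a) v"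
  "amplify (\<pi> a) (u - v) = amplify (\<pi> a) u - amplify (\<pi> a) v"
  "amplify (\<pi> a) (c *\<^sub>C v) = c *\<^sub>C amplify (\<pi> a) v"
  "amplify (\<pi> (a + b)) v = amplify (\<pi> a) v + amplify (\<pi> b) v"
  "amplify (\<pi> (c *\<^sub>C a)) v = c *\<^sub>C amplify (\<pi> a) v"
  "amplify (\<pi> (r *\<^sub>R a)) v = r *\<^sub>R amplify (\<pi> a) v"
  "amplify (\<pi> (a * b)) v = amplify (\<pi> a) (amplify (\<pi> b) v)"
  "amplify (\<pi> 1) v = v"
  "amplify (\<pi> 0) v = 0"
  by (simp_all add: vec_eq_iff rep_add_left rep_add_right rep_diff_right rep_scaleC_left
      rep_scaleC_right rep_scaleR_left rep_mult)

text \<open>Let \<open>P\<close> be the projection onto the cyclic subspace \<open>M\<close> generated by \<open>v\<close> in the direct sum. Its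
  matrix entries commute with the representation, so they are scalars by Schur's lemma; hence \<open>P\<close>
  commutes with the amplification of every operator \<open>S\<close>, and \<open>v \<in> M\<close> is moved by it within \<open>M\<close>.\<close>

theorem density:
  fixes v :: "'h ^ 'm::finite"
  assumes S: "bounded_clinear S"
  shows "amplify S v \<in> closure (range (\<lambda>a. amplify (\<pi> a) v))"
proof -
  note S' = bounded_clinearD[OF S]
  define M where "M = closure (range (\<lambda>a. amplify (\<pi> a) v))"
  have "complex_vector.subspace (range (\<lambda>a. amplify (\<pi> a) v))"
  proof (rule complex_subspaceI)
    show "0 \<in> range (\<lambda>a. amplify (\<pi> a) v)"
      by (rule range_eqI[of _ _ 0]) (simp add: amplify_rep_simps)
  next
    fix x y assume "x \<in> range (\<lambda>a. amplify (\<pi> a) v)" "y \<in> range (\<lambda>a. amplify (\<pi> a) v)"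
    then obtain a b where "x = amplify (\<pi> a) v" "y = amplify (\<pi> b) v" by blast
    then show "x + y \<in> range (\<lambda>a. amplify (\<pi> a) v)"
      by (intro range_eqI[of _ _ "a + b"]) (simp add: amplify_rep_simps)
  next
    fix c x assume "x \<in> range (\<lambda>a. amplify (\<pi> a) v)"
    then obtain a where "x = amplify (\<pi> a) v" by blast
    then show "c *\<^sub>C x \<in> range (\<lambda>a. amplify (\<pi> a) v)"
      by (intro range_eqI[of _ _ "c *\<^sub>C a"]) (simp add: amplify_rep_simps)
  qed
  then have M: "complex_vector.subspace M" "closed M"
    unfolding M_def by (auto intro: complex_subspace_closure)
  then have M_diff: "x - y \<in> M" if "x \<in> M" "y \<in> M" for x y
    using that complex_vector.subspace_diff by blast
  have "v \<in> range (\<lambda>a. amplify (\<pi> a) v)"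
    by (rule range_eqI[of _ _ 1]) (simp add: amplify_rep_simps)
  then have v_in: "v \<in> M"
    unfolding M_def by (rule subsetD[OF closure_subset])
  have inv: "amplify (\<pi> a) x \<in> M" if "x \<in> M" for a x
    using that unfolding M_def
    by (rule closure_bounded_linear[OF bounded_linear_amplify[OF rep_bounded_linear], rotated])
      (auto simp flip: amplify_rep_simps(7))
  have "\<exists>m\<in>M. \<forall>l\<in>M. cinner (x - m) l = 0" for x
    by (rule complex_orthogonal_projection[OF M, of x]) blast
  then obtain P where P: "\<And>x. P x \<in> M" "\<And>x l. l \<in> M \<Longrightarrow> cinner (x - P x) l = 0" by metis
  have P_eq: "P x = m" if "m \<in> M" "\<And>l. l \<in> M \<Longrightarrow> cinner (x - m) l = 0" for x m
  proof -
    have "P x - m \<in> M" by (intro M_diff P that)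
    then have "cinner ((x - m) - (x - P x)) (P x - m) = 0"
      unfolding cinner_diff_left[of "x - m"] using that(2) P(2) by simp
    then show ?thesis by (simp add: cinner_eq_zero_iff)
  qed
  have P_add: "P (x + y) = P x + P y" for x y
  proof (rule P_eq)
    show "P x + P y \<in> M" using M(1) P(1) by (auto simp: complex_vector.subspace_def)
    show "cinner (x + y - (P x + P y)) l = 0" if "l \<in> M" for l
      using P(2)[OF that, of x] P(2)[OF that, of y] by (simp add: cinner_simps)
  qed
  have P_scale: "P (c *\<^sub>C x) = c *\<^sub>C P x" for c x
  proof (rule P_eq)
    show "c *\<^sub>C P x \<in> M" using M(1) P(1) by (auto simp: complex_vector.subspace_def)
    show "cinner (c *\<^sub>C x - c *\<^sub>C P x) l = 0" if "l \<in> M" for l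
      using P(2)[OF that, of x] by (simp add: cinner_scaleC_left flip: scaleC.diff_right)
  qed
  have P_rep: "P (amplify (\<pi> a) x) = amplify (\<pi> a) (P x)" for a x
  proof (rule P_eq[OF inv[OF P(1)]])
    show "cinner (amplify (\<pi> a) x - amplify (\<pi> a) (P x)) l = 0" if "l \<in> M" for l
      using P(2)[OF inv[OF that]] by (simp add: cinner_amplify_rep flip: amplify_rep_simps(2))
  qed
  have P_sa: "cinner (P x) y = cinner x (P y)" for x y
  proof -
    have "cinner (P x) (y - P y) = 0" using P(2)[OF P(1)] cinner_commute complex_cnj_zero by metis
    then show ?thesis using P(2)[OF P(1), of x y] by (simp add: cinner_simps)
  qed
  have P_norm: "norm (P x) \<le> norm x" for x
  proof -
    have "(norm (P x))\<^sup>2 = Re (cinner x (P x))"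
      using P(2)[OF P(1), of x x] by (simp add: norm_sq_eq_Re_cinner cinner_simps)
    then have "norm (P x) * norm (P x) \<le> norm x * norm (P x)"
      using Re_cinner_le[of x "P x"] by (simp add: power2_eq_square)
    then show ?thesis by (cases "P x = 0") auto
  qed
  have P_lin: "bounded_linear P"
    by (rule bounded_linear_intro[of P 1]) (simp_all add: P_add P_scale P_norm scaleR_scaleC)
  define T where "T i j u = P (axis j u) $ i" for i j and u :: 'h
  have axis_simps: "axis j (u + w) = axis j u + axis j w" "axis j (c *\<^sub>C u) = c *\<^sub>C axis j u"
    "axis j (r *\<^sub>R u) = r *\<^sub>R axis j u" "amplify (\<pi> a) (axis j u) = axis j (\<pi> a u)"
    for j :: 'm and u w :: 'h and c r a
    by (auto simp: vec_eq_iff axis_def scaleC.zero_right)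
  have cinner_axis: "cinner x (axis i w) = cinner (x $ i) w"
      "cinner (axis i w) x = cinner w (x $ i)" for x :: "'h ^ 'm" and i w
    by (simp_all add: cinner_vec_def axis_def if_distrib[of "cinner _"]
        if_distrib[of "\<lambda>w. cinner w _"] cong: if_cong)
  have "(norm (axis j u))\<^sup>2 = (norm u)\<^sup>2" for j :: 'm and u :: 'h
    by (simp only: norm_sq_eq_Re_cinner cinner_axis) (simp add: axis_def)
  then have norm_axis: "norm (axis j u) = norm u" for j :: 'm and u :: 'h
    by (simp add: power2_eq_iff_nonneg)
  have "bounded_linear (\<lambda>u::'h. axis j u)" for j :: 'm
    by (rule bounded_linear_intro[of _ 1]) (simp_all add: axis_simps norm_axis)
  then have "bounded_clinear (T i j)" for i j
    unfolding T_def
    by (intro bounded_clinearI bounded_linear_compose[OF bounded_linear_vec_nth]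
        bounded_linear_compose[OF P_lin]) (simp_all add: axis_simps P_scale)
  moreover have "cinner (T i j u) w = cinner u (T j i w)" for i j u w
    using P_sa[of "axis j u" "axis i w"] by (simp add: T_def cinner_axis)
  moreover have "T i j (\<pi> a u) = \<pi> a (T i j u)" for i j a u
    by (simp add: T_def P_rep flip: axis_simps(4))
  ultimately have "\<exists>c. \<forall>u. T i j u = c *\<^sub>C u" for i j
    using schur[of "T i j" "T j i"] by blast
  then obtain c where c: "\<And>i j u. T i j u = c i j *\<^sub>C u" by metis
  have P_matrix: "P x $ i = (\<Sum>j\<in>UNIV. c i j *\<^sub>C (x $ j))" for x i
  proof -
    have "x = (\<Sum>j\<in>UNIV. axis j (x $ j))"
      by (simp add: vec_eq_iff axis_def if_distrib cong: if_cong)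
    then have "P x = (\<Sum>j\<in>UNIV. P (axis j (x $ j)))"
      using linear_sum[OF bounded_linear.linear[OF P_lin]] by metis
    then show ?thesis by (simp flip: c add: T_def)
  qed
  have "P v = v" by (rule P_eq[OF v_in]) simp
  have "P (amplify S v) $ i = amplify S v $ i" for i
  proof -
    have "P (amplify S v) $ i = S (P v $ i)"
      by (simp add: P_matrix linear_sum[OF bounded_linear.linear[OF S'(3)]] S'(2))
    then show ?thesis by (simp add: \<open>P v = v\<close>)
  qed
  then have "P (amplify S v) = amplify S v" by (simp add: vec_eq_iff)
  then show ?thesis using P(1) M_def by metis
qed

text \<open>The approximating elements can be chosen self-adjoint if \<open>S\<close> is. Otherwise some vector \<open>w\<close>, not
  orthogonal to \<open>Sv\<close> over the reals, is real-orthogonal to all \<open>\<pi>(b)v\<close> with \<open>b\<close> self-adjoint.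
  This says \<open>\<langle>w, \<pi>(a)v\<rangle> + \<langle>v, \<pi>(a)w\<rangle> = 0\<close> first for self-adjoint \<open>a\<close>, then for all \<open>a\<close> by complex
  linearity. By density for the pair \<open>(v, w)\<close> it holds for \<open>S\<close> in place of \<open>\<pi>(a)\<close>, a
  contradiction.\<close>

theorem density_selfadjoint:
  fixes v :: "'h ^ 'm::finite"
  assumes S: "bounded_clinear S" and sa: "\<And>x y. cinner (S x) y = cinner x (S y)"
  shows "amplify S v \<in> closure {amplify (\<pi> b) v | b. star b = b}"
proof -
  define L where "L = closure {amplify (\<pi> b) v | b. star b = b}"
  have "subspace {amplify (\<pi> b) v | b. star b = b}"
    unfolding subspace_def
  proof (intro conjI ballI allI)
    show "0 \<in> {amplify (\<pi> b) v | b. star b = b}"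
      by (auto intro!: exI[of _ 0] simp: amplify_rep_simps)
  next
    fix x y assume "x \<in> {amplify (\<pi> b) v | b. star b = b}" "y \<in> {amplify (\<pi> b) v | b. star b = b}"
    then obtain a b where "x = amplify (\<pi> a) v" "star a = a" "y = amplify (\<pi> b) v" "star b = b"
      by blast
    then show "x + y \<in> {amplify (\<pi> b) v | b. star b = b}"
      by (auto intro!: exI[of _ "a + b"] simp: amplify_rep_simps star_simps)
  next
    fix r x assume "x \<in> {amplify (\<pi> b) v | b. star b = b}"
    then obtain b where "x = amplify (\<pi> b) v" "star b = b" by blast
    then show "r *\<^sub>R x \<in> {amplify (\<pi> b) v | b. star b = b}"
      by (auto intro!: exI[of _ "r *\<^sub>R b"] simp: amplify_rep_simps star_simps)
  qed
  then have "subspace L" "closed L" unfolding L_def by (auto intro: real_subspace_closure)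
  then obtain m where m: "m \<in> L" "\<And>l. l \<in> L \<Longrightarrow> Re (cinner (amplify S v - m) l) = 0"
    using orthogonal_projection[of L "amplify S v"] by blast
  define w where "w = amplify S v - m"
  have "cinner w (amplify (\<pi> b) v) + cinner v (amplify (\<pi> b) w) = 0" if "star b = b" for b
  proof -
    have "amplify (\<pi> b) v \<in> L" unfolding L_def
      by (rule subsetD[OF closure_subset]) (use that in blast)
    then have "Re (cinner w (amplify (\<pi> b) v)) = 0" using m(2) by (simp add: w_def)
    moreover have "cinner v (amplify (\<pi> b) w) = cnj (cinner w (amplify (\<pi> b) v))"
      using cinner_amplify_rep[of b v w] cinner_commute[of "amplify (\<pi> b) v" w] that by simp
    ultimately show ?thesis by (simp add: complex_eq_iff)
  qed
  note sa_zero = this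
  have zero: "cinner w (amplify (\<pi> a) v) + cinner v (amplify (\<pi> a) w) = 0" for a
  proof -
    define b1 b2 where "b1 = (1/2) *\<^sub>R (a + star a)" and "b2 = (1/2) *\<^sub>R (\<i> *\<^sub>C (star a - a))"
    have b: "star b1 = b1" "star b2 = b2"
      by (simp_all add: b1_def b2_def star_simps add.commute scaleC.minus_left scaleC.diff_right)
    have "\<i> *\<^sub>C b2 = (1/2) *\<^sub>R (a - star a)"
      unfolding b2_def by (simp add: scaleR_scaleC_commute[symmetric] scaleC_simps)
    then have "a = b1 + \<i> *\<^sub>C b2"
      by (simp add: b1_def flip: scaleR_add_right)
    then have "cinner w (amplify (\<pi> a) v) + cinner v (amplify (\<pi> a) w)
        = (cinner w (amplify (\<pi> b1) v) + cinner v (amplify (\<pi> b1) w))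
          + \<i> * (cinner w (amplify (\<pi> b2) v) + cinner v (amplify (\<pi> b2) w))"
      by (simp add: amplify_rep_simps cinner_simps algebra_simps)
    then show ?thesis using sa_zero[OF b(1)] sa_zero[OF b(2)] by simp
  qed
  \<comment> \<open>Both terms together are one inner product in a direct sum of twice as many copies.\<close>
  define p :: "'h ^ ('m + 'm)" where "p = (\<chi> k. case k of Inl i \<Rightarrow> v $ i | Inr i \<Rightarrow> w $ i)"
  define q :: "'h ^ ('m + 'm)" where "q = (\<chi> k. case k of Inl i \<Rightarrow> w $ i | Inr i \<Rightarrow> v $ i)"
  have pair: "cinner q (amplify f p) = cinner w (amplify f v) + cinner v (amplify f w)" for f
    using sum.Plus[of UNIV UNIV "\<lambda>k. cinner (q $ k) (f (p $ k))"]
    by (simp add: cinner_vec_def p_def q_def)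
  have "amplify S p \<in> {z. cinner q z = 0}"
  proof (rule set_mp[OF closure_minimal density[OF S]])
    show "range (\<lambda>a. amplify (\<pi> a) p) \<subseteq> {z. cinner q z = 0}" by (auto simp: pair zero)
    show "closed {z. cinner q z = 0}"
      by (intro closed_Collect_eq continuous_intros
          bounded_linear.continuous_on[OF cinner.bounded_linear_right])
  qed
  then have "cinner w (amplify S v) + cinner v (amplify S w) = 0" by (simp add: pair)
  moreover have "cinner v (amplify S w) = cinner (amplify S v) w"
    by (simp add: cinner_vec_def sa)
  ultimately have "Re (cinner w (amplify S v)) = 0"
    using Re_cinner_commute[of w "amplify S v"] by (simp add: complex_eq_iff)
  moreover have "Re (cinner w m) = 0" using m by (simp add: w_def)
  moreover have "(norm w)\<^sup>2 = Re (cinner w (amplify S v - m))"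
    by (simp add: norm_sq_eq_Re_cinner w_def)
  ultimately have "(norm w)\<^sup>2 = 0" by (simp add: cinner_diff_right)
  then have "amplify S v = m" by (simp add: w_def)
  then show ?thesis using m(1) by (simp add: L_def)
qed

end


section \<open>A continuous partition of unity on a metric space\<close>

text \<open>
  Well-order the index set \<open>S\<close> and let \<open>f\<^bsub>s\<^esub>\<close> be a tent of height \<open>1\<close> around \<open>s\<close>. The running supremum
  \<open>F\<^bsub>s\<^esub> = sup {f\<^bsub>t\<^esub> | t < s}\<close> grows from \<open>0\<close> to \<open>1\<close> as \<open>s\<close> runs through \<open>S\<close>, and it has no
  jumps at limit steps. Hence its increments \<open>g\<^bsub>s\<^esub> = (f\<^bsub>s\<^esub> - F\<^bsub>s\<^esub>)\<^sup>+\<close> add up to \<open>1\<close>. They are continuous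
  because a supremum of equi-Lipschitz functions is Lipschitz.\<close>

theorem metric_partition_of_unity:
  fixes S :: "'b::metric_space set"
  assumes e: "0 < e"
  obtains g :: "'b \<Rightarrow> 'b \<Rightarrow> real"
  where "\<And>s y. 0 \<le> g s y" "\<And>s y. e \<le> dist s y \<Longrightarrow> g s y = 0"
    "\<And>s. continuous_on UNIV (g s)" "\<And>y. y \<in> S \<Longrightarrow> ((\<lambda>s. g s y) has_sum 1) S"
proof -
  obtain r :: "'b rel" where wo: "Well_order r" and Fr: "Field r = UNIV"
    using well_ordering[where 'a='b] by (elim exE conjE)
  define before where "before s = {t \<in> S. (t, s) \<in> r - Id}" for s
  have wf: "wf (r - Id)" using wo unfolding well_order_on_def by blast
  have total: "s = t \<or> (s, t) \<in> r - Id \<or> (t, s) \<in> r - Id" for s t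
    using wo Fr unfolding order_on_defs total_on_def by blast
  have trans: "(s, u) \<in> r - Id" if "(s, t) \<in> r - Id" "(t, u) \<in> r - Id" for s t u
  proof -
    have "trans r" "antisym r" using wo unfolding order_on_defs by blast+
    then show ?thesis using that by (blast dest: transD antisymD)
  qed
  have before_trans: "t \<in> before s" if "t \<in> before m" "m \<in> before s" for t m s
    using that trans unfolding before_def by blast
  define f where "f s y = max 0 (1 - dist s y / e)" for s y :: 'b
  define F where "F s y = Sup (insert 0 ((\<lambda>t. f t y) ` before s))" for s y
  define g where "g s y = max 0 (f s y - F s y)" for s y
  have f01: "0 \<le> f s y" "f s y \<le> 1" for s y
    using e by (auto simp: f_def)
  have bdd: "bdd_above (insert 0 ((\<lambda>t. f t y) ` before s))" for s y
    by (auto intro!: bdd_aboveI2[of _ _ 1] f01)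
  have F_ge: "f t y \<le> F s y" if "t \<in> before s" for t s y
    unfolding F_def by (rule cSup_upper) (use that bdd in auto)
  have F_pos: "0 \<le> F s y" for s y
    unfolding F_def by (rule cSup_upper) (use bdd in auto)
  have F_le: "F s y \<le> c" if "0 \<le> c" "\<And>t. t \<in> before s \<Longrightarrow> f t y \<le> c" for s y c
    unfolding F_def by (rule cSup_least) (use that in auto)
  have f_lip: "f s y \<le> f s z + dist y z / e" for s y z
  proof -
    have "dist s z / e \<le> dist s y / e + dist y z / e"
      using e dist_triangle[of s z y] by (simp add: divide_right_mono flip: add_divide_distrib)
    moreover have "0 \<le> dist y z / e" using e by simp
    ultimately show ?thesis by (auto simp: f_def max_def)
  qed
  have F_lip: "F s y \<le> F s z + dist y z / e" for s y z
  proof (rule F_le)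
    show "0 \<le> F s z + dist y z / e" using F_pos[of s z] e by simp
    show "f t y \<le> F s z + dist y z / e" if "t \<in> before s" for t
      using f_lip[of t y z] F_ge[OF that, of z] by linarith
  qed
  have cont: "continuous_on UNIV h"
    if lip: "\<And>y z. h y \<le> h z + dist y z / e" for h :: "'b \<Rightarrow> real"
  proof (rule continuous_on_iff[THEN iffD2], intro ballI allI impI)
    fix y and d :: real assume d: "0 < d"
    have "dist (h z) (h y) \<le> dist z y / e" for z
      using lip[of z y] lip[of y z] by (simp add: dist_real_def dist_commute abs_le_iff)
    moreover have "dist z y / e < d" if "dist z y < d * e" for z
      using that e by (simp add: pos_divide_less_eq)
    ultimately have "dist (h z) (h y) < d" if "dist z y < d * e" for z
      using that le_less_trans by blast
    then show "\<exists>d'>0. \<forall>z\<in>UNIV. dist z y < d' \<longrightarrow> dist (h z) (h y) < d"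
      using d e by (intro exI[of _ "d * e"]) auto
  qed
  have g_cont: "continuous_on UNIV (g s)" for s
    unfolding g_def by (intro continuous_intros cont f_lip F_lip)
  have g_pos: "0 \<le> g s y" for s y by (simp add: g_def)
  have g_le: "g s y \<le> f s y" for s y
    using F_pos f01 by (simp add: g_def)
  have g_supp: "g s y = 0" if "e \<le> dist s y" for s y
    using that e g_le[of s y] g_pos[of s y] by (simp add: f_def)
  have ex_last: "\<exists>m\<in>A. \<forall>t\<in>A. t \<noteq> m \<longrightarrow> (t, m) \<in> r - Id" if "finite A" "A \<noteq> {}" for A
    using that
  proof (induct rule: finite_ne_induct)
    case (insert x A)
    then obtain m where m: "m \<in> A" "\<And>t. t \<in> A \<Longrightarrow> t \<noteq> m \<Longrightarrow> (t, m) \<in> r - Id" by blast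
    have "x \<noteq> m" using insert m by blast
    with total[of x m] consider "(x, m) \<in> r - Id" | "(m, x) \<in> r - Id" by blast
    then show ?case
    proof cases
      case 1
      then show ?thesis using m by (intro bexI[of _ m]) auto
    next
      case 2
      then have "(t, x) \<in> r - Id" if "t \<in> A" for t
        using m(2)[OF that] trans that by blast
      then show ?thesis by (intro bexI[of _ x]) auto
    qed
  qed simp
  have upper_before: "\<forall>A. finite A \<longrightarrow> A \<subseteq> before s \<longrightarrow> (\<Sum>t\<in>A. g t y) \<le> F s y" for s y
  proof (induct s rule: wf_induct_rule[OF wf])
    case (1 s)
    show ?case
    proof (intro allI impI)
      fix A assume A: "finite A" "A \<subseteq> before s"
      show "(\<Sum>t\<in>A. g t y) \<le> F s y"
      proof (cases "A = {}")
        case False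
        then obtain m where m: "m \<in> A" "\<And>t. t \<in> A \<Longrightarrow> t \<noteq> m \<Longrightarrow> (t, m) \<in> r - Id"
          using ex_last[OF A(1) False] by blast
        have ms: "m \<in> before s" "(m, s) \<in> r - Id" using m(1) A(2) unfolding before_def by blast+
        have "A - {m} \<subseteq> before m" using m(2) A(2) unfolding before_def by blast
        then have "(\<Sum>t\<in>A - {m}. g t y) \<le> F m y" using 1[OF ms(2)] A(1) by simp
        then have "(\<Sum>t\<in>A. g t y) \<le> F m y + g m y"
          using A(1) m(1) by (simp add: sum.remove)
        also have "\<dots> = max (F m y) (f m y)" by (simp add: g_def)
        also have "\<dots> \<le> F s y"
        proof -
          have "F m y \<le> F s y"
            by (rule F_le[OF F_pos F_ge[OF before_trans[OF _ ms(1)]]])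
          then show ?thesis using F_ge[OF ms(1)] by simp
        qed
        finally show ?thesis .
      qed (simp add: F_pos)
    qed
  qed
  have upper: "(\<Sum>t\<in>A. g t y) \<le> 1" if A: "finite A" "A \<subseteq> S" for A y
  proof (cases "A = {}")
    case False
    then obtain m where m: "m \<in> A" "\<And>t. t \<in> A \<Longrightarrow> t \<noteq> m \<Longrightarrow> (t, m) \<in> r - Id"
      using ex_last[OF A(1) False] by blast
    have "A - {m} \<subseteq> before m" using m(2) A(2) unfolding before_def by blast
    then have "(\<Sum>t\<in>A - {m}. g t y) \<le> F m y" using upper_before A(1) by blast
    then have "(\<Sum>t\<in>A. g t y) \<le> F m y + g m y"
      using A(1) m(1) by (simp add: sum.remove)
    also have "\<dots> = max (F m y) (f m y)" by (simp add: g_def)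
    also have "\<dots> \<le> 1" using F_le[of 1 m y] f01 by simp
    finally show ?thesis .
  qed simp
  have summable: "(\<lambda>t. g t y) summable_on A" if "A \<subseteq> S" for A y
    by (rule nonneg_bdd_above_summable_on)
      (use that upper g_pos in \<open>auto intro!: bdd_aboveI2[of _ _ 1]\<close>)
  have lower: "s \<in> S \<longrightarrow> f s y \<le> infsum (\<lambda>t. g t y) (insert s (before s))" for s y
  proof (induct s rule: wf_induct_rule[OF wf])
    case (1 s)
    show ?case
    proof
      assume s: "s \<in> S"
      have sub: "before s \<subseteq> S" by (auto simp: before_def)
      have "F s y \<le> infsum (\<lambda>t. g t y) (before s)"
      proof (rule F_le)
        show "0 \<le> infsum (\<lambda>t. g t y) (before s)" by (intro infsum_nonneg g_pos)
        fix t assume t: "t \<in> before s"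
        then have "f t y \<le> infsum (\<lambda>t. g t y) (insert t (before t))"
          using 1 by (auto simp: before_def)
        also have "\<dots> \<le> infsum (\<lambda>t. g t y) (before s)"
        proof (rule infsum_mono2)
          show "insert t (before t) \<subseteq> before s"
            using t before_trans[OF _ t] by blast
        qed (use t sub g_pos in \<open>auto intro!: summable simp: before_def\<close>)
        finally show "f t y \<le> infsum (\<lambda>t. g t y) (before s)" .
      qed
      moreover have "f s y \<le> g s y + F s y" by (simp add: g_def)
      moreover have "infsum (\<lambda>t. g t y) (insert s (before s))
          = g s y + infsum (\<lambda>t. g t y) (before s)"
        using summable[OF sub] by (subst infsum_insert) (auto simp: before_def)
      ultimately show "f s y \<le> infsum (\<lambda>t. g t y) (insert s (before s))" by linarith
    qed
  qed
  have "((\<lambda>s. g s y) has_sum 1) S" if y: "y \<in> S" for y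
  proof -
    have "1 = f y y" by (simp add: f_def)
    also have "\<dots> \<le> infsum (\<lambda>t. g t y) (insert y (before y))" using lower y by blast
    also have "\<dots> \<le> infsum (\<lambda>t. g t y) S"
      by (rule infsum_mono2) (use y g_pos in \<open>auto intro!: summable simp: before_def\<close>)
    finally have "1 \<le> infsum (\<lambda>t. g t y) S" .
    moreover have "infsum (\<lambda>t. g t y) S \<le> 1"
      by (rule infsum_le_finite_sums[OF summable[OF order_refl] upper])
    ultimately have "infsum (\<lambda>t. g t y) S = 1" by simp
    then show ?thesis using has_sum_infsum[OF summable[OF order_refl]] by metis
  qed
  from that[OF g_pos g_supp g_cont this] show ?thesis .
qed


section \<open>Continuous right inverses of linear maps between Banach spaces\<close>

lemma weighted_sum:
  fixes a :: "'s \<Rightarrow> 'a::banach" and g :: "'s \<Rightarrow> 'b::topological_space \<Rightarrow> real"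
  assumes g: "\<And>s y. 0 \<le> g s y" "\<And>s. continuous_on Y (g s)"
      "\<And>y. y \<in> Y \<Longrightarrow> ((\<lambda>s. g s y) has_sum 1) S"
    and a: "\<And>s. s \<in> S \<Longrightarrow> norm (a s) \<le> C"
  shows weighted_sum_summable: "\<And>y. y \<in> Y \<Longrightarrow> (\<lambda>s. g s y *\<^sub>R a s) summable_on S"
    and continuous_on_weighted_sum: "continuous_on Y (\<lambda>y. infsum (\<lambda>s. g s y *\<^sub>R a s) S)"
proof -
  have le: "norm (g s y *\<^sub>R a s) \<le> C * g s y" if "s \<in> S" for s y
    using mult_right_mono[OF a[OF that] g(1)[of s y]] g(1)[of s y] by (simp add: mult.commute)
  show summable: "(\<lambda>s. g s y *\<^sub>R a s) summable_on S" if y: "y \<in> Y" for y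
  proof (rule abs_summable_summable[OF summable_on_comparison_test])
    show "(\<lambda>s. C * g s y) summable_on S"
      using g(3)[OF y] by (intro summable_on_cmult_right) (auto simp: summable_on_def)
  qed (use le in auto)
  define G where "G y = infsum (\<lambda>s. g s y *\<^sub>R a s) S" for y
  have remainder: "norm (G y - (\<Sum>s\<in>A. g s y *\<^sub>R a s)) \<le> C * (1 - (\<Sum>s\<in>A. g s y))"
    if y: "y \<in> Y" and A: "finite A" "A \<subseteq> S" for y A
  proof (rule norm_infsum_le)
    show "((\<lambda>s. g s y *\<^sub>R a s) has_sum G y - (\<Sum>s\<in>A. g s y *\<^sub>R a s)) (S - A)"
      unfolding G_def by (intro has_sum_Diff has_sum_infsum summable[OF y] has_sum_finite A)
    show "((\<lambda>s. C * g s y) has_sum C * (1 - (\<Sum>s\<in>A. g s y))) (S - A)"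
      by (intro has_sum_cmult_right has_sum_Diff g(3)[OF y] has_sum_finite A)
  qed (use le in auto)
  \<comment> \<open>A finite partial sum carries almost all the weight at a point, hence also near it.\<close>
  have "continuous_on Y G"
    unfolding continuous_on_def
  proof (intro ballI tendstoI)
    fix y0 e assume y0: "y0 \<in> Y" and e: "0 < (e::real)"
    define d where "d = e / (2 * (\<bar>C\<bar> + 1))"
    have d: "0 < d" using e by (simp add: d_def)
    obtain A where A: "finite A" "A \<subseteq> S" "dist (\<Sum>s\<in>A. g s y0) 1 \<le> d"
      using has_sum_finite_approximation[OF g(3)[OF y0] d] by blast
    define D where "D y = norm ((\<Sum>s\<in>A. g s y *\<^sub>R a s) - (\<Sum>s\<in>A. g s y0 *\<^sub>R a s))
        + C * (1 - (\<Sum>s\<in>A. g s y)) + C * (1 - (\<Sum>s\<in>A. g s y0))" for y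
    have "1 - (\<Sum>s\<in>A. g s y0) \<le> d" using A(3) by (simp add: dist_real_def)
    moreover have "0 \<le> 1 - (\<Sum>s\<in>A. g s y0)"
      using finite_sum_le_has_sum[OF g(3)[OF y0] A(1,2)] g(1) by simp
    ultimately have "C * (1 - (\<Sum>s\<in>A. g s y0)) \<le> \<bar>C\<bar> * d"
      by (intro mult_mono) auto
    moreover have "2 * (\<bar>C\<bar> * d) < e" using e by (simp add: d_def field_simps)
    ultimately have "D y0 < e" by (simp add: D_def)
    moreover have "continuous_on Y D"
      unfolding D_def by (intro continuous_intros g(2))
    ultimately have "eventually (\<lambda>y. D y < e) (at y0 within Y)"
      using y0 by (metis continuous_on_def order_tendstoD(2))
    moreover have "eventually (\<lambda>y. y \<in> Y) (at y0 within Y)"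
      by (simp add: eventually_at_filter)
    ultimately show "eventually (\<lambda>y. dist (G y) (G y0) < e) (at y0 within Y)"
    proof eventually_elim
      case (elim y)
      have "norm (G y - G y0) \<le> norm (G y - (\<Sum>s\<in>A. g s y *\<^sub>R a s))
          + norm ((\<Sum>s\<in>A. g s y *\<^sub>R a s) - (\<Sum>s\<in>A. g s y0 *\<^sub>R a s))
          + norm (G y0 - (\<Sum>s\<in>A. g s y0 *\<^sub>R a s))"
        by norm
      also have "\<dots> \<le> D y"
        using remainder[OF elim(2) A(1,2)] remainder[OF y0 A(1,2)] by (simp add: D_def)
      finally show ?case using elim(1) by (simp add: dist_norm)
    qed
  qed
  then show "continuous_on Y (\<lambda>y. infsum (\<lambda>s. g s y *\<^sub>R a s) S)" by (simp add: G_def)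
qed

text \<open>
  The map \<open>\<Phi>\<close> is assumed to hit the unit sphere of \<open>Z\<close> only approximately, but with a uniform bound on
  the preimages. Averaging such preimages with a partition of unity gives a continuous map \<open>G\<close> on the
  sphere, extended homogeneously to \<open>E\<close>, for which \<open>z - \<Phi>(Ez)\<close> has at most half the norm of \<open>z\<close>.
  Correcting the error again and again is a geometric series, uniformly convergent on bounded sets.
  Nothing better than such a nonlinear right inverse can be expected: a bounded linear one would force
  the kernel of \<open>\<Phi>\<close> to be complemented.\<close>

theorem continuous_right_inverse:
  fixes \<Phi> :: "'a::banach \<Rightarrow> 'b::real_normed_vector"
  assumes \<Phi>: "bounded_linear \<Phi>" and Z: "subspace Z" "\<And>a. \<Phi> a \<in> Z"
    and approx: "\<And>z. z \<in> Z \<Longrightarrow> norm z = 1 \<Longrightarrow> \<exists>a. norm a \<le> C \<and> norm (\<Phi> a - z) \<le> 1/4"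
  obtains \<sigma> where "continuous_on Z \<sigma>" "\<sigma> 0 = 0" "\<And>z. z \<in> Z \<Longrightarrow> \<Phi> (\<sigma> z) = z"
proof -
  interpret \<Phi>: bounded_linear \<Phi> by fact
  define S where "S = {z \<in> Z. norm z = 1}"
  have "\<forall>z. \<exists>a. z \<in> S \<longrightarrow> norm a \<le> C \<and> norm (\<Phi> a - z) \<le> 1/4"
    using approx unfolding S_def by blast
  then obtain a where a: "\<And>s. s \<in> S \<Longrightarrow> norm (a s) \<le> C" "\<And>s. s \<in> S \<Longrightarrow> norm (\<Phi> (a s) - s) \<le> 1/4"
    by metis
  obtain g :: "'b \<Rightarrow> 'b \<Rightarrow> real" where g: "\<And>s y. 0 \<le> g s y"
      "\<And>s. continuous_on UNIV (g s)" "\<And>y. y \<in> S \<Longrightarrow> ((\<lambda>s. g s y) has_sum 1) S"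
    and g_supp: "\<And>s y. 1/4 \<le> dist s y \<Longrightarrow> g s y = 0"
    by (rule metric_partition_of_unity[of "1/4" S]) auto
  have g_cont: "continuous_on Y (g s)" for s Y using g(2) continuous_on_subset by blast
  define G where "G y = infsum (\<lambda>s. g s y *\<^sub>R a s) S" for y
  have G_cont: "continuous_on S G"
    unfolding G_def by (rule continuous_on_weighted_sum[OF g(1) g_cont g(3) a(1)])
  have G_sum: "((\<lambda>s. g s y *\<^sub>R a s) has_sum G y) S" if "y \<in> S" for y
    unfolding G_def by (rule has_sum_infsum[OF weighted_sum_summable[OF g(1) g_cont g(3) a(1) that]])
  have G_norm: "norm (G y) \<le> C" if y: "y \<in> S" for y
  proof -
    have "norm (G y) \<le> C * 1"
      by (rule norm_infsum_le[OF G_sum[OF y] has_sum_cmult_right[OF g(3)[OF y]]])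
        (simp add: g(1) mult.commute[of C] mult_left_mono a(1))
    then show ?thesis by simp
  qed
  have G_approx: "norm (\<Phi> (G y) - y) \<le> 1/2" if y: "y \<in> S" for y
  proof -
    have "((\<lambda>s. g s y *\<^sub>R \<Phi> (a s)) has_sum \<Phi> (G y)) S"
      using has_sum_bounded_linear[OF \<Phi> G_sum[OF y]] by (simp add: \<Phi>.scaleR)
    moreover have "((\<lambda>s. g s y *\<^sub>R y) has_sum y) S"
      using has_sum_bounded_linear[OF bounded_linear_scaleR_left[of y] g(3)[OF y]] by simp
    then have "((\<lambda>s. - (g s y *\<^sub>R y)) has_sum - y) S"
      by (rule has_sum_bounded_linear[OF bounded_linear_minus[OF bounded_linear_ident]])
    ultimately have sum: "((\<lambda>s. g s y *\<^sub>R \<Phi> (a s) - g s y *\<^sub>R y) has_sum (\<Phi> (G y) - y)) S"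
      unfolding diff_conv_add_uminus by (rule has_sum_add)
    have "norm (\<Phi> (G y) - y) \<le> 1/2 * 1"
    proof (rule norm_infsum_le[OF sum has_sum_cmult_right[OF g(3)[OF y]]])
      fix s assume s: "s \<in> S"
      show "norm (g s y *\<^sub>R \<Phi> (a s) - g s y *\<^sub>R y) \<le> 1/2 * g s y"
      proof (cases "1/4 \<le> dist s y")
        case False
        then have "norm (\<Phi> (a s) - y) \<le> 1/2"
          using a(2)[OF s] norm_triangle_ineq[of "\<Phi> (a s) - s" "s - y"] by (simp add: dist_norm)
        then have "g s y * norm (\<Phi> (a s) - y) \<le> g s y * (1/2)"
          by (rule mult_left_mono) (rule g(1))
        moreover have "norm (g s y *\<^sub>R \<Phi> (a s) - g s y *\<^sub>R y) = g s y * norm (\<Phi> (a s) - y)"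
          using g(1)[of s y] by (simp flip: scaleR_diff_right)
        ultimately show ?thesis by linarith
      qed (simp add: g_supp)
    qed
    then show ?thesis by simp
  qed
  define E where "E z = (if z = 0 then 0 else norm z *\<^sub>R G (inverse (norm z) *\<^sub>R z))" for z
  have in_S: "inverse (norm z) *\<^sub>R z \<in> S" if "z \<in> Z" "z \<noteq> 0" for z
    using that Z(1) by (simp add: S_def subspace_def)
  define K where "K = max C 0"
  have E_norm: "norm (E z) \<le> K * norm z" if "z \<in> Z" for z
  proof (cases "z = 0")
    case False
    then have "norm (G (inverse (norm z) *\<^sub>R z)) \<le> K"
      using G_norm[OF in_S[OF that False]] by (simp add: K_def)
    then show ?thesis using False by (simp add: E_def mult.commute mult_left_mono)
  qed (simp add: E_def)
  have E_approx: "norm (z - \<Phi> (E z)) \<le> norm z / 2" if "z \<in> Z" for z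
  proof (cases "z = 0")
    case False
    define y where "y = inverse (norm z) *\<^sub>R z"
    have "z - \<Phi> (E z) = - (norm z *\<^sub>R (\<Phi> (G y) - y))"
      using False by (simp add: E_def \<Phi>.scaleR y_def scaleR_diff_right)
    then have "norm (z - \<Phi> (E z)) = norm z * norm (\<Phi> (G y) - y)"
      by (metis norm_minus_cancel norm_scaleR abs_norm_cancel)
    also have "\<dots> \<le> norm z * (1/2)"
      using G_approx[OF in_S[OF that False]] by (intro mult_left_mono) (simp_all add: y_def)
    finally show ?thesis by simp
  qed (simp add: E_def \<Phi>.zero)
  have E_cont: "continuous_on Z E"
    unfolding continuous_on_def
  proof
    fix z assume z: "z \<in> Z"
    show "(E \<longlongrightarrow> E z) (at z within Z)"
    proof (cases "z = 0")
      case True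
      have "eventually (\<lambda>z. z \<in> Z) (at 0 within Z)" by (simp add: eventually_at_filter)
      then have "eventually (\<lambda>z. norm (E z) \<le> K * norm z) (at 0 within Z)"
        by eventually_elim (rule E_norm)
      moreover have "((\<lambda>z::'b. K * norm z) \<longlongrightarrow> K * norm (0::'b)) (at 0 within Z)"
        by (intro tendsto_intros)
      ultimately have "(E \<longlongrightarrow> 0) (at 0 within Z)"
        using Lim_null_comparison[of E "\<lambda>z. K * norm z"] by simp
      then show ?thesis using True by (simp add: E_def)
    next
      case False
      have "continuous_on (Z - {0}) (\<lambda>z. norm z *\<^sub>R G (inverse (norm z) *\<^sub>R z))"
        by (intro continuous_intros continuous_on_compose2[OF G_cont]) (auto intro: in_S)
      then have "continuous_on (Z - {0}) E"
        by (rule continuous_on_eq) (simp add: E_def)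
      then have "(E \<longlongrightarrow> E z) (at z within (Z - {0}))"
        using z False by (simp add: continuous_on_def)
      moreover have "at z within (Z - {0}) = at z within Z"
        by (rule at_within_nhd[of _ "- {0}"]) (use False in auto)
      ultimately show ?thesis by simp
    qed
  qed
  define R where "R k = ((\<lambda>z. z - \<Phi> (E z)) ^^ k)" for k
  have R0: "R 0 z = z" and RS: "R (Suc k) z = R k z - \<Phi> (E (R k z))" for k z
    by (simp_all add: R_def)
  have R_in: "R k z \<in> Z" if "z \<in> Z" for k z
    by (induct k) (use that Z in \<open>simp_all add: R0 RS subspace_diff\<close>)
  have R_norm: "norm (R k z) \<le> norm z / 2 ^ k" if "z \<in> Z" for k z
  proof (induct k)
    case (Suc k)
    then show ?case using E_approx[OF R_in[OF that, of k]] by (simp add: RS)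
  qed (simp add: R0)
  have R_cont: "continuous_on Z (R k)" for k
  proof (induct k)
    case (Suc k)
    have "continuous_on Z (\<lambda>z. R k z - \<Phi> (E (R k z)))"
      by (intro continuous_intros Suc \<Phi>.continuous_on continuous_on_compose2[OF E_cont Suc])
        (use R_in in auto)
    then show ?case by (simp add: RS)
  qed (simp add: R0)
  have ER_norm: "norm (E (R k z)) \<le> K * B * (1/2) ^ k" if "z \<in> Z" "norm z \<le> B" for k z B
  proof -
    have "norm (E (R k z)) \<le> K * (norm z / 2 ^ k)"
      by (rule order_trans[OF E_norm[OF R_in[OF that(1)]] mult_left_mono[OF R_norm[OF that(1)]]])
        (simp add: K_def)
    also have "\<dots> \<le> K * (B / 2 ^ k)"
      using that(2) by (intro mult_left_mono divide_right_mono) (auto simp: K_def)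
    finally show ?thesis by (simp add: power_one_over)
  qed
  have summable_bound: "summable (\<lambda>k. K * B * (1/2) ^ k)" for B :: real
    by (intro summable_mult summable_geometric) simp
  define \<sigma> where "\<sigma> z = (\<Sum>k. E (R k z))" for z
  have "continuous_on Z \<sigma>"
    unfolding continuous_on_def
  proof
    fix z assume z: "z \<in> Z"
    define Y where "Y = Z \<inter> ball 0 (norm z + 1)"
    have "uniform_limit Y (\<lambda>n z. \<Sum>k<n. E (R k z)) \<sigma> sequentially"
      unfolding \<sigma>_def
      by (rule Weierstrass_m_test[OF _ summable_bound[of "norm z + 1"]], rule ER_norm)
        (auto simp: Y_def)
    moreover have "continuous_on Y (\<lambda>z. \<Sum>k<n. E (R k z))" for n
      by (intro continuous_intros continuous_on_compose2[OF E_cont]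
          continuous_on_subset[OF R_cont]) (auto simp: Y_def R_in)
    ultimately have "continuous_on Y \<sigma>"
      by (intro uniform_limit_theorem[where F = sequentially]) auto
    then have "(\<sigma> \<longlongrightarrow> \<sigma> z) (at z within Y)" using z by (simp add: continuous_on_def Y_def)
    moreover have "at z within Y = at z within Z"
      by (rule at_within_nhd[of _ "ball 0 (norm z + 1)"]) (auto simp: Y_def)
    ultimately show "(\<sigma> \<longlongrightarrow> \<sigma> z) (at z within Z)" by simp
  qed
  moreover have "R k 0 = 0" for k
    by (induct k) (simp_all add: R0 RS E_def \<Phi>.zero)
  then have "\<sigma> 0 = 0" by (simp add: \<sigma>_def E_def)
  moreover have "\<Phi> (\<sigma> z) = z" if z: "z \<in> Z" for z
  proof -
    have "summable (\<lambda>k. E (R k z))"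
      by (rule summable_comparison_test'[OF summable_bound ER_norm[OF z order_refl]])
    then have "(\<lambda>k. \<Phi> (E (R k z))) sums \<Phi> (\<sigma> z)"
      unfolding \<sigma>_def by (intro \<Phi>.sums summable_sums)
    moreover have "(\<lambda>k. norm z / 2 ^ k) \<longlonglongrightarrow> 0" by (rule LIMSEQ_divide_realpow_zero) simp
    then have "(\<lambda>k. R k z) \<longlonglongrightarrow> 0"
      by (rule Lim_null_comparison[rotated]) (simp add: R_norm z)
    then have "(\<lambda>k. R k z - R (Suc k) z) sums (R 0 z - 0)" by (rule telescope_sums')
    then have "(\<lambda>k. \<Phi> (E (R k z))) sums z" by (simp add: RS R0)
    ultimately show ?thesis by (rule sums_unique2)
  qed
  ultimately show ?thesis by (rule that)
qed


section \<open>Interpolation by self-adjoint elements\<close>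

lemma dual_basis:
  fixes \<xi> :: "'h::chilbert_space ^ 'n::finite"
  assumes \<xi>: "clinearly_independent \<xi>"
  obtains \<delta> :: "'h ^ 'n" where "\<And>i j. cinner (\<delta> $ i) (\<xi> $ j) = (if i = j then 1 else 0)"
proof -
  define G :: "complex ^ 'n ^ 'n" where "G = (\<chi> i j. cinner (\<xi> $ i) (\<xi> $ j))"
  have "c = 0" if c: "G *v c = 0" for c :: "complex ^ 'n"
  proof -
    define u where "u = (\<Sum>j\<in>UNIV. (c $ j) *\<^sub>C (\<xi> $ j))"
    have "cinner (\<xi> $ i) u = (G *v c) $ i" for i
      by (simp add: u_def G_def cinner_sum_right cinner_scaleC_right matrix_vector_mult_def mult.commute)
    then have "cinner u u = 0"
      by (subst u_def) (simp add: c cinner_sum_left cinner_scaleC_left)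
    then have "u = 0" by (simp add: cinner_eq_zero_iff)
    then show ?thesis
      using \<xi> unfolding clinearly_independent_def u_def by (simp add: vec_eq_iff)
  qed
  then obtain B where B: "B ** G = mat 1"
    using matrix_left_invertible_ker[of G] by blast
  define \<delta> :: "'h ^ 'n" where "\<delta> = (\<chi> i. \<Sum>k\<in>UNIV. cnj (B $ i $ k) *\<^sub>C (\<xi> $ k))"
  have "cinner (\<delta> $ i) (\<xi> $ j) = (B ** G) $ i $ j" for i j
    by (simp add: \<delta>_def G_def matrix_matrix_mult_def cinner_sum_left cinner_scaleC_left)
  then show ?thesis using that[of \<delta>] by (simp add: B mat_def)
qed

text \<open>The tuples that are images of \<open>\<xi>\<close> under a self-adjoint operator satisfy this condition, and for
  linearly independent \<open>\<xi>\<close> it is sufficient.\<close>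

definition symmetric_images :: "'h::chilbert_space ^ 'n \<Rightarrow> ('h ^ 'n) set" where
  "symmetric_images \<xi> = {\<zeta>. \<forall>i j. cinner (\<xi> $ i) (\<zeta> $ j) = cinner (\<zeta> $ i) (\<xi> $ j)}"

lemma subspace_symmetric_images: "subspace (symmetric_images \<xi>)"
  by (simp add: subspace_def symmetric_images_def cinner_simps)

lemma selfadjoint_operator_interpolation:
  fixes \<xi> :: "'h::chilbert_space ^ 'n::finite"
  assumes \<xi>: "clinearly_independent \<xi>"
  obtains M where "0 \<le> M" "\<And>\<zeta>. \<zeta> \<in> symmetric_images \<xi> \<Longrightarrow>
    \<exists>S. bounded_clinear S \<and> (\<forall>u v. cinner (S u) v = cinner u (S v)) \<and>
        (\<forall>i. S (\<xi> $ i) = \<zeta> $ i) \<and> (\<forall>v. norm (S v) \<le> M * norm \<zeta> * norm v)"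
proof -
  obtain \<delta> where \<delta>: "\<And>i j. cinner (\<delta> $ i) (\<xi> $ j) = (if i = j then 1 else 0)"
    using dual_basis[OF \<xi>] by metis
  define M where "M = (\<Sum>i\<in>(UNIV::'n set). norm (\<delta> $ i)) + (\<Sum>i\<in>(UNIV::'n set). norm (\<delta> $ i))
    + (\<Sum>i\<in>(UNIV::'n set). \<Sum>j\<in>(UNIV::'n set). norm (\<delta> $ i) * norm (\<xi> $ j) * norm (\<delta> $ j))"
  show ?thesis
  proof
    show "0 \<le> M" unfolding M_def by (intro add_nonneg_nonneg sum_nonneg mult_nonneg_nonneg norm_ge_zero)
    fix \<zeta> assume \<zeta>: "\<zeta> \<in> symmetric_images \<xi>"
    have sym: "cinner (\<xi> $ i) (\<zeta> $ j) = cinner (\<zeta> $ i) (\<xi> $ j)" for i j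
      using \<zeta> by (simp add: symmetric_images_def)
    \<comment> \<open>Let \<open>L\<close> be the first sum; it maps \<open>\<xi>\<close> to \<open>\<zeta>\<close>. The second sum is the adjoint of \<open>L\<close>, and the
      third is \<open>PL\<close> for the projection \<open>P\<close> onto the span of \<open>\<xi>\<close>. By the symmetry of \<open>\<zeta>\<close> the operator
      \<open>PL\<close> is self-adjoint and agrees with the adjoint of \<open>L\<close> on this span.\<close>
    define S where "S v = (\<Sum>i\<in>UNIV. cinner (\<delta> $ i) v *\<^sub>C (\<zeta> $ i))
      + (\<Sum>i\<in>UNIV. cinner (\<zeta> $ i) v *\<^sub>C (\<delta> $ i))
      - (\<Sum>i\<in>UNIV. \<Sum>j\<in>UNIV. (cinner (\<xi> $ j) (\<zeta> $ i) * cinner (\<delta> $ i) v) *\<^sub>C (\<delta> $ j))" for v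
    have lin: "bounded_linear (\<lambda>v. (c * cinner u v) *\<^sub>C w)" for c and u w :: 'h
      by (intro bounded_linear_compose[OF scaleC.bounded_linear_left]
          bounded_linear_compose[OF bounded_linear_mult_right] cinner.bounded_linear_right)
    have "bounded_linear S"
      unfolding S_def using lin[of 1]
      by (intro bounded_linear_sub bounded_linear_add bounded_linear_sum lin) simp_all
    then have "bounded_clinear S"
      by (rule bounded_clinearI)
        (simp add: S_def cinner_scaleC_right scaleC.diff_right scaleC_add_right scaleC.sum_right
          scaleC_scaleC mult_ac)
    moreover have "cinner (S u) v = cinner u (S v)" for u v
    proof -
      have swap: "(\<Sum>i\<in>UNIV. \<Sum>j\<in>UNIV. cinner (\<zeta> $ i) (\<xi> $ j) * cinner u (\<delta> $ i) * cinner (\<delta> $ j) v)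
          = (\<Sum>i\<in>UNIV. \<Sum>j\<in>UNIV. cinner (\<xi> $ j) (\<zeta> $ i) * cinner (\<delta> $ i) v * cinner u (\<delta> $ j))"
        by (subst sum.swap) (simp add: sym mult_ac)
      show ?thesis
        using swap
        by (simp add: S_def cinner_simps cinner_sum_left cinner_sum_right mult_ac
            flip: cinner_commute[of u] cinner_commute[of _ "_ $ _"])
    qed
    moreover have "S (\<xi> $ k) = \<zeta> $ k" for k
    proof -
      have "(\<Sum>i\<in>UNIV. \<Sum>j\<in>UNIV. (cinner (\<xi> $ j) (\<zeta> $ i) * cinner (\<delta> $ i) (\<xi> $ k)) *\<^sub>C (\<delta> $ j))
          = (\<Sum>j\<in>UNIV. cinner (\<xi> $ j) (\<zeta> $ k) *\<^sub>C (\<delta> $ j))"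
        by (subst sum.swap) (simp add: \<delta> if_distrib if_distribR scaleC.zero_left cong: if_cong)
      then show ?thesis
        by (simp add: S_def \<delta> sym if_distrib if_distribR scaleC.zero_left scaleC_one cong: if_cong)
    qed
    moreover have "norm (S v) \<le> M * norm \<zeta> * norm v" for v
    proof -
      have 1: "norm (\<Sum>i\<in>UNIV. cinner (\<delta> $ i) v *\<^sub>C (\<zeta> $ i)) \<le> (\<Sum>i\<in>(UNIV::'n set). norm (\<delta> $ i) * norm v * norm \<zeta>)"
        by (intro sum_norm_le) (simp add: norm_scaleC mult_mono norm_cinner_le
            Finite_Cartesian_Product.norm_nth_le)
      have 2: "norm (\<Sum>i\<in>UNIV. cinner (\<zeta> $ i) v *\<^sub>C (\<delta> $ i)) \<le> (\<Sum>i\<in>(UNIV::'n set). norm \<zeta> * norm v * norm (\<delta> $ i))"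
        by (intro sum_norm_le) (auto simp: norm_scaleC intro!: mult_right_mono order_trans[OF norm_cinner_le]
            Finite_Cartesian_Product.norm_nth_le)
      have 3: "norm (\<Sum>i\<in>UNIV. \<Sum>j\<in>UNIV. (cinner (\<xi> $ j) (\<zeta> $ i) * cinner (\<delta> $ i) v) *\<^sub>C (\<delta> $ j))
          \<le> (\<Sum>i\<in>(UNIV::'n set). \<Sum>j\<in>(UNIV::'n set). norm (\<xi> $ j) * norm \<zeta> * (norm (\<delta> $ i) * norm v) * norm (\<delta> $ j))"
        by (intro sum_norm_le) (auto simp: norm_scaleC norm_mult
            intro!: mult_right_mono mult_mono norm_cinner_le order_trans[OF norm_cinner_le]
             mult_left_mono Finite_Cartesian_Product.norm_nth_le)
      have "norm (S v) \<le> (\<Sum>i\<in>(UNIV::'n set). norm (\<delta> $ i) * norm v * norm \<zeta>)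
          + (\<Sum>i\<in>(UNIV::'n set). norm \<zeta> * norm v * norm (\<delta> $ i))
          + (\<Sum>i\<in>(UNIV::'n set). \<Sum>j\<in>(UNIV::'n set). norm (\<xi> $ j) * norm \<zeta> * (norm (\<delta> $ i) * norm v) * norm (\<delta> $ j))"
        unfolding S_def
        by (rule order_trans[OF norm_triangle_ineq4 add_mono[OF order_trans[OF norm_triangle_ineq add_mono[OF 1 2]] 3]])
      also have "\<dots> = M * norm \<zeta> * norm v"
        by (simp add: M_def sum_distrib_left sum_distrib_right distrib_left distrib_right mult_ac)
      finally show ?thesis .
    qed
    ultimately show "\<exists>S. bounded_clinear S \<and> (\<forall>u v. cinner (S u) v = cinner u (S v)) \<and>
        (\<forall>i. S (\<xi> $ i) = \<zeta> $ i) \<and> (\<forall>v. norm (S v) \<le> M * norm \<zeta> * norm v)"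
      by blast
  qed
qed

lemma norm_vec_le_sum: "norm (v :: 'a::real_normed_vector ^ 'n) \<le> (\<Sum>i\<in>UNIV. norm (v $ i))"
  unfolding norm_vec_def by (rule L2_set_le_sum) simp


context irreducible_rep
begin

lemma bounded_linear_amplify_rep: "bounded_linear (\<lambda>a. amplify (\<pi> a) (v :: 'h ^ 'n::finite))"
proof (rule bounded_linear_intro)
  show "norm (amplify (\<pi> a) v) \<le> norm a * (\<Sum>i\<in>UNIV. norm (v $ i))" for a
  proof -
    have "norm (amplify (\<pi> a) v) \<le> (\<Sum>i\<in>UNIV. norm (\<pi> a (v $ i)))"
      using norm_vec_le_sum[of "amplify (\<pi> a) v"] by simp
    also have "\<dots> \<le> (\<Sum>i\<in>UNIV. norm a * norm (v $ i))"
      by (intro sum_mono norm_rep_le)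
    finally show ?thesis by (simp add: sum_distrib_left)
  qed
qed (simp_all add: amplify_rep_simps)

lemma density_selfadjoint_pair:
  fixes v w :: "'h ^ 'n::finite"
  assumes S: "bounded_clinear S" "\<And>x y. cinner (S x) y = cinner x (S y)" and d: "0 < d"
  obtains b where "star b = b" "\<And>i. norm (\<pi> b (v $ i) - S (v $ i)) \<le> d"
    "\<And>i. norm (\<pi> b (w $ i) - S (w $ i)) \<le> d"
proof -
  define p :: "'h ^ ('n + 'n)" where "p = (\<chi> k. case k of Inl i \<Rightarrow> v $ i | Inr i \<Rightarrow> w $ i)"
  obtain b where b: "star b = b" "dist (amplify (\<pi> b) p) (amplify S p) < d"
    using density_selfadjoint[OF S, of p] d unfolding closure_approachable by blast
  have "norm (\<pi> b (p $ k) - S (p $ k)) \<le> d" for k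
    using b(2) Finite_Cartesian_Product.norm_nth_le[of "amplify (\<pi> b) p - amplify S p" k]
    by (simp add: dist_norm)
  from this[of "Inl _"] this[of "Inr _"] b(1) show ?thesis
    by (intro that) (simp_all add: p_def)
qed

text \<open>
  A quantitative substitute for surjectivity, in the spirit of Kaplansky's density theorem: density
  gives a self-adjoint \<open>b\<close>, of uncontrolled norm, such that \<open>\<pi>(b)\<close> is close to a small operator \<open>S\<close> on
  finitely many vectors. With \<open>c = (1 - ib)\<^sup>-\<^sup>1\<close> the element \<open>a = -i (c - c\<^sup>*) = 2b (1 + b\<^sup>2)\<^sup>-\<^sup>1\<close> has norm at
  most \<open>2\<close>, and as \<open>S\<close> is small, \<open>\<pi>(a)\<close> acts on these vectors like \<open>2S\<close> up to second order.\<close>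

lemma approximate_interpolation:
  fixes \<xi> :: "'h ^ 'n::finite"
  assumes \<xi>: "clinearly_independent \<xi>"
  obtains C where "\<And>\<zeta>. \<zeta> \<in> symmetric_images \<xi> \<Longrightarrow> norm \<zeta> = 1 \<Longrightarrow>
    \<exists>a. star a = a \<and> norm a \<le> C \<and> norm (amplify (\<pi> a) \<xi> - \<zeta>) \<le> 1/4"
proof -
  obtain M where M: "0 \<le> M" and interp: "\<And>\<zeta>. \<zeta> \<in> symmetric_images \<xi> \<Longrightarrow>
    \<exists>S. bounded_clinear S \<and> (\<forall>u v. cinner (S u) v = cinner u (S v)) \<and>
        (\<forall>i. S (\<xi> $ i) = \<zeta> $ i) \<and> (\<forall>v. norm (S v) \<le> M * norm \<zeta> * norm v)"
    using selfadjoint_operator_interpolation[OF \<xi>] by metis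
  define N where "N = real CARD('n)"
  have N: "0 < N" by (simp add: N_def)
  \<comment> \<open>The length to which \<open>\<zeta>\<close> is scaled, and the precision of the approximation; they make both
    errors below at most \<open>r/8\<close>.\<close>
  define r where "r = 1 / (4 * N * (M + 1))"
  define d where "d = r / (32 * N)"
  have r: "0 < r" and d: "0 < d" using N M by (simp_all add: r_def d_def)
  have "\<exists>a. star a = a \<and> norm a \<le> 2 / r \<and> norm (amplify (\<pi> a) \<xi> - \<zeta>) \<le> 1/4"
    if \<zeta>: "\<zeta> \<in> symmetric_images \<xi>" "norm \<zeta> = 1" for \<zeta>
  proof -
    define z where "z = (r/2) *\<^sub>R \<zeta>"
    have "z \<in> symmetric_images \<xi>"
      unfolding z_def by (intro subspace_mul subspace_symmetric_images \<zeta>)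
    then obtain S where S: "bounded_clinear S" "\<And>u v. cinner (S u) v = cinner u (S v)"
      and S_\<xi>: "\<And>i. S (\<xi> $ i) = z $ i" and S_norm: "\<And>v. norm (S v) \<le> M * norm z * norm v"
      using interp by metis
    obtain b where b: "star b = b" and b_\<xi>: "\<And>i. norm (\<pi> b (\<xi> $ i) - S (\<xi> $ i)) \<le> d"
      and b_z: "\<And>i. norm (\<pi> b (z $ i) - S (z $ i)) \<le> d"
      by (rule density_selfadjoint_pair[OF S d, of \<xi> z]) blast
    have norm_z: "norm z = r / 2" using r \<zeta>(2) by (simp add: z_def)
    define \<epsilon> where "\<epsilon> = 2 * d + M * (r/2)\<^sup>2"
    have S_z: "norm (S (z $ i)) \<le> M * (r/2)\<^sup>2" for i
    proof -
      have "norm (S (z $ i)) \<le> M * norm z * norm (z $ i)" by (rule S_norm)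
      also have "\<dots> \<le> M * norm z * norm z"
        using M by (intro mult_left_mono Finite_Cartesian_Product.norm_nth_le) auto
      finally show ?thesis by (simp add: norm_z power2_eq_square)
    qed
    have resolvent: "norm (\<pi> c (\<xi> $ i) - \<xi> $ i - k *\<^sub>C (z $ i)) \<le> \<epsilon>"
      if c: "c * (1 - k *\<^sub>C b) = 1" "norm c \<le> 1" and k: "cmod k = 1" for c k i
    proof -
      have c_eq: "\<pi> c u = u + k *\<^sub>C \<pi> c (\<pi> b u)" for u
      proof -
        have "c = 1 + k *\<^sub>C (c * b)" using c(1) by (simp add: right_diff_distrib mult_scaleC_right diff_eq_eq)
        then have "\<pi> c u = \<pi> (1 + k *\<^sub>C (c * b)) u" by simp
        then show ?thesis by (simp add: rep_add_left rep_scaleC_left rep_mult)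
      qed
      have c_le: "norm (k *\<^sub>C \<pi> c u) \<le> norm u" for u
        using norm_rep_le[of c u] mult_right_mono[OF c(2), of "norm u"] k by (simp add: norm_scaleC)
      have "\<pi> c (\<xi> $ i) - \<xi> $ i - k *\<^sub>C (z $ i)
          = k *\<^sub>C \<pi> c (\<pi> b (\<xi> $ i) - z $ i) + k *\<^sub>C (\<pi> c (z $ i) - z $ i)"
        by (subst c_eq) (simp add: rep_diff_right scaleC.diff_right)
      also have "\<pi> c (z $ i) - z $ i = k *\<^sub>C \<pi> c (\<pi> b (z $ i))"
        by (subst c_eq) simp
      finally have "norm (\<pi> c (\<xi> $ i) - \<xi> $ i - k *\<^sub>C (z $ i))
          \<le> norm (\<pi> b (\<xi> $ i) - z $ i) + norm (\<pi> b (z $ i))"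
        using norm_triangle_mono[OF c_le[of "\<pi> b (\<xi> $ i) - z $ i"],
            of "k *\<^sub>C k *\<^sub>C \<pi> c (\<pi> b (z $ i))"] c_le[of "\<pi> b (z $ i)"] k
        by (simp add: norm_scaleC norm_mult)
      also have "\<dots> \<le> d + (d + M * (r/2)\<^sup>2)"
        using b_\<xi>[of i] norm_triangle_sub[of "\<pi> b (z $ i)" "S (z $ i)"] b_z[of i] S_z[of i]
        by (simp add: S_\<xi>)
      finally show ?thesis by (simp add: \<epsilon>_def)
    qed
    define c where "c = cayley_resolvent b"
    define a where "a = (- \<i>) *\<^sub>C (c - star c)"
    have c: "(1 - \<i> *\<^sub>C b) * c = 1" "c * (1 - \<i> *\<^sub>C b) = 1" "norm c \<le> 1"
      using cayley_resolvent[OF b] by (simp_all add: c_def)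
    have c_star: "star c * (1 - (- \<i>) *\<^sub>C b) = 1"
      using arg_cong[OF c(1), of star] by (simp add: star_simps b)
    have a_star: "star a = a"
      by (simp add: a_def star_simps scaleC.diff_right scaleC.minus_left)
    have a_norm: "norm a \<le> 2"
      using norm_triangle_ineq4[of c "star c"] c(3) by (simp add: a_def norm_scaleC)
    have "norm (\<pi> a (\<xi> $ i) - r *\<^sub>R (\<zeta> $ i)) \<le> 2 * \<epsilon>" for i
    proof -
      define p q where "p = \<pi> c (\<xi> $ i) - \<xi> $ i - \<i> *\<^sub>C (z $ i)"
        and "q = \<pi> (star c) (\<xi> $ i) - \<xi> $ i - (- \<i>) *\<^sub>C (z $ i)"
      have "\<pi> c (\<xi> $ i) - \<pi> (star c) (\<xi> $ i) = (p - q) + \<i> *\<^sub>C (r *\<^sub>R (\<zeta> $ i))"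
      proof -
        have "r *\<^sub>R (\<zeta> $ i) = z $ i + z $ i" by (simp add: z_def flip: scaleR_add_left)
        then show ?thesis by (simp add: p_def q_def scaleC.minus_left scaleC_add_right)
      qed
      then have "\<pi> a (\<xi> $ i) - r *\<^sub>R (\<zeta> $ i) = (- \<i>) *\<^sub>C (p - q)"
        unfolding a_def rep_scaleC_left rep_diff_left
        by (simp only: scaleC_add_right scaleC_scaleC) (simp add: scaleC_one)
      then have "norm (\<pi> a (\<xi> $ i) - r *\<^sub>R (\<zeta> $ i)) = norm (p - q)" by (simp add: norm_scaleC)
      also have "\<dots> \<le> \<epsilon> + \<epsilon>"
        using resolvent[OF c(2,3)] resolvent[OF c_star] c(3)
        by (intro order_trans[OF norm_triangle_ineq4 add_mono]) (simp_all add: p_def q_def)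
      finally show ?thesis by simp
    qed
    then have "norm (amplify (\<pi> a) \<xi> - r *\<^sub>R \<zeta>) \<le> (\<Sum>i\<in>(UNIV::'n set). 2 * \<epsilon>)"
      by (intro order_trans[OF norm_vec_le_sum sum_mono]) simp
    also have "\<dots> = 4 * N * d + N * M * r\<^sup>2 / 2"
      by (simp add: N_def \<epsilon>_def power2_eq_square field_simps)
    also have "\<dots> \<le> r / 8 + r / 8"
    proof (rule add_mono)
      show "4 * N * d \<le> r / 8" using N by (simp add: d_def)
      have "M + 1 \<noteq> 0" using M by simp
      then have "4 * (N * M * r) = M / (M + 1)" using N by (simp add: r_def frac_eq_eq)
      also have "\<dots> \<le> 1" using M by simp
      finally have "4 * (N * M * r) \<le> 1" .
      then have "(4 * (N * M * r)) * r \<le> 1 * r" using r by (intro mult_right_mono) auto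
      then show "N * M * r\<^sup>2 / 2 \<le> r / 8" by (simp add: power2_eq_square mult_ac)
    qed
    finally have small: "norm (amplify (\<pi> a) \<xi> - r *\<^sub>R \<zeta>) \<le> r / 4" by simp
    have "amplify (\<pi> (inverse r *\<^sub>R a)) \<xi> - \<zeta> = inverse r *\<^sub>R (amplify (\<pi> a) \<xi> - r *\<^sub>R \<zeta>)"
      using r by (simp add: amplify_rep_simps scaleR_diff_right)
    then have "norm (amplify (\<pi> (inverse r *\<^sub>R a)) \<xi> - \<zeta>)
        = inverse r * norm (amplify (\<pi> a) \<xi> - r *\<^sub>R \<zeta>)"
      using r by (simp only: norm_scaleR) simp
    also have "\<dots> \<le> inverse r * (r / 4)" using r by (intro mult_left_mono small) simp
    also have "\<dots> = 1/4" using r by simp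
    finally have "norm (amplify (\<pi> (inverse r *\<^sub>R a)) \<xi> - \<zeta>) \<le> 1/4" .
    moreover have "norm (inverse r *\<^sub>R a) \<le> 2 / r" using a_norm r by (simp add: field_simps)
    ultimately show ?thesis
      using a_star by (intro exI[of _ "inverse r *\<^sub>R a"]) (simp add: star_scaleR)
  qed
  then show ?thesis by (rule that)
qed


section \<open>Continuous transitivity for self-adjoint and for arbitrary elements\<close>

text \<open>The map \<open>a \<mapsto> \<pi>((a + a\<^sup>*)/2)\<xi>\<close> is real linear on the whole algebra, so that the theorem on
  continuous right inverses applies to it directly.\<close>

theorem selfadjoint_section:
  fixes \<xi> :: "'h ^ 'n::finite"
  assumes \<xi>: "clinearly_independent \<xi>"
  obtains g where "continuous_on (symmetric_images \<xi>) g" "g 0 = 0"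
    "\<And>\<zeta>. \<zeta> \<in> symmetric_images \<xi> \<Longrightarrow> star (g \<zeta>) = g \<zeta>"
    "\<And>\<zeta> i. \<zeta> \<in> symmetric_images \<xi> \<Longrightarrow> \<pi> (g \<zeta>) (\<xi> $ i) = \<zeta> $ i"
proof -
  define re where "re a = (1/2) *\<^sub>R (a + star a)" for a :: 'a
  have re_star: "star (re a) = re a" for a by (simp add: re_def star_simps add.commute)
  have re_id: "re a = a" if "star a = a" for a
    using that by (simp add: re_def flip: scaleR_2)
  have re_lin: "bounded_linear re"
    unfolding re_def
    by (intro bounded_linear_const_scaleR bounded_linear_add bounded_linear_ident bounded_linear_star)
  define \<Phi> where "\<Phi> a = amplify (\<pi> (re a)) \<xi>" for a
  have \<Phi>_lin: "bounded_linear \<Phi>"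
    unfolding \<Phi>_def by (rule bounded_linear_compose[OF bounded_linear_amplify_rep re_lin])
  have \<Phi>_in: "\<Phi> a \<in> symmetric_images \<xi>" for a
    by (simp add: symmetric_images_def \<Phi>_def rep_adjoint re_star)
  obtain C where C: "\<And>\<zeta>. \<zeta> \<in> symmetric_images \<xi> \<Longrightarrow> norm \<zeta> = 1 \<Longrightarrow>
      \<exists>a. star a = a \<and> norm a \<le> C \<and> norm (amplify (\<pi> a) \<xi> - \<zeta>) \<le> 1/4"
    using approximate_interpolation[OF \<xi>] by metis
  have approx: "\<exists>a. norm a \<le> C \<and> norm (\<Phi> a - \<zeta>) \<le> 1/4"
    if "\<zeta> \<in> symmetric_images \<xi>" "norm \<zeta> = 1" for \<zeta>
    using C[OF that] re_id unfolding \<Phi>_def by metis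
  obtain \<sigma> where \<sigma>: "continuous_on (symmetric_images \<xi>) \<sigma>" "\<sigma> 0 = 0"
      "\<And>\<zeta>. \<zeta> \<in> symmetric_images \<xi> \<Longrightarrow> \<Phi> (\<sigma> \<zeta>) = \<zeta>"
    by (rule continuous_right_inverse[OF \<Phi>_lin subspace_symmetric_images \<Phi>_in approx]) blast+
  show ?thesis
  proof (rule that[of "\<lambda>\<zeta>. re (\<sigma> \<zeta>)"])
    show "continuous_on (symmetric_images \<xi>) (\<lambda>\<zeta>. re (\<sigma> \<zeta>))"
      by (rule bounded_linear.continuous_on[OF re_lin \<sigma>(1)])
    show "re (\<sigma> 0) = 0" by (simp add: \<sigma>(2) re_def)
    show "star (re (\<sigma> \<zeta>)) = re (\<sigma> \<zeta>)" for \<zeta> by (rule re_star)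
    show "\<pi> (re (\<sigma> \<zeta>)) (\<xi> $ i) = \<zeta> $ i" if "\<zeta> \<in> symmetric_images \<xi>" for \<zeta> i
      using arg_cong[OF \<sigma>(3)[OF that], of "\<lambda>v. v $ i"] by (simp add: \<Phi>_def)
  qed
qed

text \<open>Every tuple \<open>\<zeta>\<close> is \<open>\<zeta>\<^sub>1 + i \<zeta>\<^sub>2\<close> with \<open>\<zeta>\<^sub>1\<close>, \<open>\<zeta>\<^sub>2\<close> images of \<open>\<xi>\<close> under self-adjoint operators: these are
  the self-adjoint parts of the operator \<open>\<Sum>\<^sub>k \<langle>\<delta>\<^sub>k, _\<rangle> \<zeta>\<^sub>k\<close>, whose adjoint sends \<open>\<xi>\<close> to the tuple
  \<open>adj \<zeta>\<close>.\<close>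

theorem transitivity_section:
  fixes \<xi> :: "'h ^ 'n::finite"
  assumes \<xi>: "clinearly_independent \<xi>"
  obtains s where "continuous_on UNIV s" "s 0 = 0" "\<And>\<zeta> i. \<pi> (s \<zeta>) (\<xi> $ i) = \<zeta> $ i"
proof -
  obtain g where g: "continuous_on (symmetric_images \<xi>) g" "g 0 = 0"
    "\<And>\<zeta> i. \<zeta> \<in> symmetric_images \<xi> \<Longrightarrow> \<pi> (g \<zeta>) (\<xi> $ i) = \<zeta> $ i"
    using selfadjoint_section[OF \<xi>] by metis
  obtain \<delta> where \<delta>: "\<And>i j. cinner (\<delta> $ i) (\<xi> $ j) = (if i = j then 1 else 0)"
    using dual_basis[OF \<xi>] by metis
  define adj where "adj \<zeta> = (\<chi> i. \<Sum>k\<in>UNIV. cinner (\<zeta> $ k) (\<xi> $ i) *\<^sub>C (\<delta> $ k))" for \<zeta> :: "'h ^ 'n"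
  have adj2: "cinner (adj \<zeta> $ i) (\<xi> $ j) = cinner (\<xi> $ i) (\<zeta> $ j)" for \<zeta> i j
    using cinner_commute[of "\<zeta> $ j" "\<xi> $ i"] cinner_commute[of "\<xi> $ i" "\<zeta> $ j"]
    by (simp add: adj_def cinner_sum_left cinner_scaleC_left \<delta> if_distrib cong: if_cong)
  have adj1: "cinner (\<xi> $ i) (adj \<zeta> $ j) = cinner (\<zeta> $ i) (\<xi> $ j)" for \<zeta> i j
    by (metis adj2 cinner_commute)
  define \<zeta>1 where "\<zeta>1 \<zeta> = (1/2) *\<^sub>R (\<zeta> + adj \<zeta>)" for \<zeta>
  define \<zeta>2 where "\<zeta>2 \<zeta> = (- \<i> / 2) *\<^sub>C (\<zeta> - adj \<zeta>)" for \<zeta>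
  have in1: "\<zeta>1 \<zeta> \<in> symmetric_images \<xi>" and in2: "\<zeta>2 \<zeta> \<in> symmetric_images \<xi>" for \<zeta>
    by (simp_all add: symmetric_images_def \<zeta>1_def \<zeta>2_def cinner_simps adj1 adj2 algebra_simps)
  have sum: "\<zeta>1 \<zeta> + \<i> *\<^sub>C \<zeta>2 \<zeta> = \<zeta>" for \<zeta>
  proof -
    have "\<i> *\<^sub>C \<zeta>2 \<zeta> = (1/2) *\<^sub>R (\<zeta> - adj \<zeta>)"
      by (simp add: \<zeta>2_def scaleC_scaleC scaleR_scaleC)
    then show ?thesis by (simp add: \<zeta>1_def flip: scaleR_add_right)
  qed
  have adj_cont: "continuous_on UNIV adj"
    unfolding adj_def
    by (intro continuous_intros scaleC.continuous_on cinner.continuous_on)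
  have cont1: "continuous_on UNIV \<zeta>1" unfolding \<zeta>1_def by (intro continuous_intros adj_cont)
  have cont2: "continuous_on UNIV \<zeta>2"
    unfolding \<zeta>2_def by (intro continuous_intros scaleC.continuous_on adj_cont)
  show ?thesis
  proof (rule that[of "\<lambda>\<zeta>. g (\<zeta>1 \<zeta>) + \<i> *\<^sub>C g (\<zeta>2 \<zeta>)"])
    show "continuous_on UNIV (\<lambda>\<zeta>. g (\<zeta>1 \<zeta>) + \<i> *\<^sub>C g (\<zeta>2 \<zeta>))"
      by (intro continuous_intros scaleC.continuous_on continuous_on_compose2[OF g(1) cont1]
          continuous_on_compose2[OF g(1) cont2]) (auto simp: in1 in2)
    have "adj 0 = 0" by (simp add: adj_def vec_eq_iff scaleC.zero_left)
    then show "g (\<zeta>1 0) + \<i> *\<^sub>C g (\<zeta>2 0) = 0"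
      by (simp add: \<zeta>1_def \<zeta>2_def g(2) scaleC.zero_right)
    show "\<pi> (g (\<zeta>1 \<zeta>) + \<i> *\<^sub>C g (\<zeta>2 \<zeta>)) (\<xi> $ i) = \<zeta> $ i" for \<zeta> i
      using arg_cong[OF sum[of \<zeta>], of "\<lambda>v. v $ i"]
      by (simp add: rep_add_left rep_scaleC_left g(3)[OF in1] g(3)[OF in2])
  qed
qed

end


section \<open>Unitarily related tuples\<close>

lemma unitary_operator_cinner:
  assumes "T \<in> unitary_operators"
  shows "cinner (T u) (T v) = cinner u v"
proof -
  obtain S where S: "is_cadjoint S T" "S \<circ> T = id"
    using assms by (auto simp: unitary_operators_def)
  then have "cinner (T u) (T v) = cinner u (S (T v))" by (simp add: is_cadjoint_def)
  also have "S (T v) = v" using fun_cong[OF S(2), of v] by simp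
  finally show ?thesis .
qed

lemma X_u_cinner:
  assumes "(x, y) \<in> X_u"
  shows "cinner (y $ i) (y $ j) = cinner (x $ i) (x $ j)"
proof -
  obtain T where T: "T \<in> unitary_operators" "\<And>i. T (x $ i) = y $ i"
    using assms by (auto simp: X_u_def)
  then show ?thesis using unitary_operator_cinner[OF T(1), of "x $ i" "x $ j"] by (simp add: T(2))
qed

lemma orthogonal_family_finite:
  fixes f :: "'s \<Rightarrow> 'h::chilbert_space" and \<xi> :: "'h ^ 'n::finite"
  assumes nonzero: "\<And>s. s \<in> A \<Longrightarrow> f s \<noteq> 0"
    and orth: "\<And>s t. s \<in> A \<Longrightarrow> t \<in> A \<Longrightarrow> s \<noteq> t \<Longrightarrow> cinner (f s) (f t) = 0"
    and span: "\<And>s. s \<in> A \<Longrightarrow> \<exists>c. f s = (\<Sum>i\<in>UNIV. c i *\<^sub>C (\<xi> $ i))"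
  shows "finite A"
proof -
  have "f s \<noteq> f t" if "s \<in> A" "t \<in> A" "s \<noteq> t" for s t
    using orth[OF that] nonzero[OF that(1)] cinner_eq_zero_iff by metis
  then have inj: "inj_on f A" by (auto simp: inj_on_def)
  have "complex_vector.independent (f ` A)"
    unfolding complex_vector.dependent_explicit
  proof clarify
    fix t u v assume t: "finite t" "t \<subseteq> f ` A" and sum: "(\<Sum>v\<in>t. u v *\<^sub>C v) = 0" and v: "v \<in> t" "u v \<noteq> 0"
    have "cinner v w = 0" if "w \<in> t" "w \<noteq> v" for w
      using that v(1) t(2) orth by blast
    then have "cinner v (\<Sum>v\<in>t. u v *\<^sub>C v) = (\<Sum>w\<in>t. if w = v then u v * cinner v v else 0)"
      unfolding cinner_sum_right by (intro sum.cong) (auto simp: cinner_scaleC_right)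
    then have "u v * cinner v v = 0" using t(1) v(1) sum by simp
    then have "v = 0" using v(2) by (simp add: cinner_eq_zero_iff)
    moreover obtain s where "s \<in> A" "v = f s" using v(1) t(2) by auto
    ultimately show False using nonzero by simp
  qed
  moreover have "f ` A \<subseteq> complex_vector.span (range (\<lambda>i. \<xi> $ i))"
  proof clarify
    fix s assume "s \<in> A"
    then obtain c where c: "f s = (\<Sum>i\<in>UNIV. c i *\<^sub>C (\<xi> $ i))" using span by blast
    show "f s \<in> complex_vector.span (range (\<lambda>i. \<xi> $ i))"
      unfolding c
      by (intro complex_vector.span_sum complex_vector.span_scale complex_vector.span_base rangeI)
  qed
  ultimately have "finite (f ` A)"
    using complex_vector.independent_span_bound[of "range (\<lambda>i. \<xi> $ i)" "f ` A"] by simp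
  then show ?thesis using inj by (rule finite_imageD)
qed

text \<open>If \<open>Tx = y\<close> and \<open>x + \<omega>y\<close> is linearly dependent, then \<open>-1/\<omega>\<close> is an eigenvalue of the unitary \<open>T\<close>
  with an eigenvector in the span of \<open>x\<close>. Eigenvectors for different eigenvalues are orthogonal, so
  only finitely many \<open>\<omega>\<close> are excluded.\<close>

lemma independent_rotated_sum:
  fixes x y :: "'h::chilbert_space ^ 'n::finite"
  assumes xy: "(x, y) \<in> X_u"
  obtains \<omega> where "cmod \<omega> = 1" "clinearly_independent (x + \<omega> *\<^sub>C y)"
proof (rule ccontr)
  assume "\<not> thesis"
  then have no: "\<not> clinearly_independent (x + c *\<^sub>C y)" if "cmod c = 1" for c
    using \<open>\<And>\<omega>. cmod \<omega> = 1 \<Longrightarrow> clinearly_independent (x + \<omega> *\<^sub>C y) \<Longrightarrow> thesis\<close> that by blast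
  obtain T where x: "clinearly_independent x" and T: "T \<in> unitary_operators" "\<And>i. T (x $ i) = y $ i"
    using xy by (auto simp: X_u_def)
  have T_clin: "bounded_clinear T" using T(1) by (simp add: unitary_operators_def)
  note T' = bounded_clinearD[OF T_clin]
  have T_sum: "T (\<Sum>i\<in>UNIV. c i *\<^sub>C (x $ i)) = (\<Sum>i\<in>UNIV. c i *\<^sub>C (y $ i))" for c
    by (simp add: linear_sum[OF bounded_linear.linear[OF T'(3)]] T'(2) T(2))
  \<comment> \<open>Infinitely many different points of the unit circle suffice as candidates.\<close>
  define \<omega> where "\<omega> t = Complex t (sqrt (1 - t\<^sup>2))" for t
  have \<omega>: "cmod (\<omega> t) = 1" if "t \<in> {0..1}" for t
    using that by (simp add: \<omega>_def cmod_def power_le_one)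
  have "\<exists>c. (\<Sum>i\<in>UNIV. c i *\<^sub>C (x $ i)) \<noteq> 0 \<and>
      (\<Sum>i\<in>UNIV. c i *\<^sub>C (x $ i)) + \<omega> t *\<^sub>C T (\<Sum>i\<in>UNIV. c i *\<^sub>C (x $ i)) = 0"
    if t: "t \<in> {0..1}" for t
  proof -
    have "\<not> clinearly_independent (x + \<omega> t *\<^sub>C y)" by (rule no[OF \<omega>[OF t]])
    then obtain c i where c: "(\<Sum>i\<in>UNIV. c i *\<^sub>C ((x + \<omega> t *\<^sub>C y) $ i)) = 0" "c i \<noteq> 0"
      by (auto simp: clinearly_independent_def)
    then have "(\<Sum>i\<in>UNIV. c i *\<^sub>C (x $ i)) + \<omega> t *\<^sub>C T (\<Sum>i\<in>UNIV. c i *\<^sub>C (x $ i)) = 0"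
      by (simp add: T_sum scaleC_add_right sum.distrib scaleC.sum_right scaleC_scaleC mult.commute)
    moreover have "(\<Sum>i\<in>UNIV. c i *\<^sub>C (x $ i)) \<noteq> 0"
      using x c(2) by (auto simp: clinearly_independent_def)
    ultimately show ?thesis by blast
  qed
  then obtain c where c: "\<And>t. t \<in> {0..1} \<Longrightarrow> (\<Sum>i\<in>UNIV. c t i *\<^sub>C (x $ i)) \<noteq> 0"
      "\<And>t. t \<in> {0..1} \<Longrightarrow>
        (\<Sum>i\<in>UNIV. c t i *\<^sub>C (x $ i)) + \<omega> t *\<^sub>C T (\<Sum>i\<in>UNIV. c t i *\<^sub>C (x $ i)) = 0"
    by metis
  define f where "f t = (\<Sum>i\<in>UNIV. c t i *\<^sub>C (x $ i))" for t
  have orth: "cinner (f s) (f t) = 0" if st: "s \<in> {0..1}" "t \<in> {0..1}" "s \<noteq> t" for s t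
  proof -
    have f_eq: "f r = - (\<omega> r *\<^sub>C T (f r))" if "r \<in> {0..1}" for r
      using c(2)[OF that] by (simp add: f_def eq_neg_iff_add_eq_0)
    have "cinner (f s) (f t) = cnj (\<omega> s) * \<omega> t * cinner (T (f s)) (T (f t))"
      by (subst f_eq[OF st(1)], subst f_eq[OF st(2)]) (simp add: cinner_simps)
    then have "cinner (f s) (f t) = 0 \<or> cnj (\<omega> s) * \<omega> t = 1"
      by (simp add: unitary_operator_cinner[OF T(1)])
    moreover have "cnj (\<omega> s) * \<omega> t \<noteq> 1"
    proof
      assume "cnj (\<omega> s) * \<omega> t = 1"
      then have "\<omega> s * cnj (\<omega> s) * \<omega> t = \<omega> s" by simp
      then have "\<omega> t = \<omega> s" using \<omega>[OF st(1)] by (simp flip: complex_norm_square)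
      then show False using st(3) by (simp add: \<omega>_def)
    qed
    ultimately show ?thesis by blast
  qed
  have "finite {0..1::real}"
    by (rule orthogonal_family_finite[of _ f x]) (use c(1) orth in \<open>auto simp: f_def\<close>)
  then show False by (simp add: infinite_Icc)
qed

context irreducible_rep
begin

text \<open>The Cayley transform turns the equation \<open>\<pi>(u)x = y\<close> for a unitary \<open>u\<close> into the linear equation
  \<open>\<pi>(h)(x + y) = -i(y - x)\<close> for a self-adjoint \<open>h\<close>.\<close>

lemma rep_cayley:
  assumes h: "star h = h" and eq: "\<pi> h (x + y) = (- \<i>) *\<^sub>C (y - x)"
  shows "\<pi> (2 * cayley_resolvent h - 1) x = y"
proof -
  have "\<pi> (1 - \<i> *\<^sub>C h) (x + y) = 2 *\<^sub>R x"
    by (simp only: rep_diff_left rep_scaleC_left eq rep_one scaleC_scaleC)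
      (simp add: scaleC_one scaleR_2)
  then have "\<pi> (cayley_resolvent h) (2 *\<^sub>R x) = x + y"
    by (metis rep_mult rep_one cayley_resolvent(2)[OF h])
  then show ?thesis
    by (simp add: rep_diff_left rep_add_left rep_add_right mult_2 scaleR_2)
qed

text \<open>
  After multiplication of \<open>y\<close> by a fixed phase \<open>\<omega>\<close> the tuple \<open>\<xi> = x + \<omega>y\<close> is linearly independent at the
  base point. Equality of the Gram matrices of \<open>x\<close> and \<open>y\<close> says exactly that \<open>\<xi>\<close> and \<open>\<eta> = -i(\<omega>y - x)\<close>
  satisfy the symmetry condition for a self-adjoint \<open>h\<close> with \<open>\<pi>(h)\<xi> = \<eta>\<close>. The section of self-adjoint
  elements is available only for the fixed tuple \<open>\<xi>\<^sub>0\<close>; conjugation by an invertible \<open>a\<close> with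
  \<open>\<pi>(a)\<xi>\<^sub>0 = \<xi>\<close>, depending continuously on \<open>\<xi>\<close>, moves the problem there.\<close>

theorem local_unitary_section:
  fixes x0 y0 :: "'h ^ 'n::finite"
  assumes xy0: "(x0, y0) \<in> X_u"
  shows "\<exists>(N :: (('h ^ 'n) \<times> ('h ^ 'n)) set) (U :: ('h ^ 'n) \<times> ('h ^ 'n) \<Rightarrow> 'a).
           openin (top_of_set X_u) N \<and> (x0, y0) \<in> N \<and>
           continuous_on N U \<and> U ` N \<subseteq> unitary_elements \<and>
           (\<forall>x y. (x, y) \<in> N \<longrightarrow> (\<forall>i. \<pi> (U (x, y)) (x $ i) = y $ i))"
proof -
  obtain \<omega> where \<omega>: "cmod \<omega> = 1" and indep: "clinearly_independent (x0 + \<omega> *\<^sub>C y0)"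
    by (rule independent_rotated_sum[OF xy0])
  have \<omega>_cnj: "cnj \<omega> * \<omega> = 1" "\<omega> * cnj \<omega> = 1"
    using \<omega> complex_norm_square[of \<omega>] by (simp_all add: mult.commute[of "cnj \<omega>"])
  define \<xi>0 where "\<xi>0 = x0 + \<omega> *\<^sub>C y0"
  obtain g where g_cont: "continuous_on (symmetric_images \<xi>0) g"
    and g_star: "\<And>\<zeta>. \<zeta> \<in> symmetric_images \<xi>0 \<Longrightarrow> star (g \<zeta>) = g \<zeta>"
    and g: "\<And>\<zeta> i. \<zeta> \<in> symmetric_images \<xi>0 \<Longrightarrow> \<pi> (g \<zeta>) (\<xi>0 $ i) = \<zeta> $ i"
    using selfadjoint_section[OF indep[folded \<xi>0_def]] by metis
  obtain s where s_cont: "continuous_on UNIV s" and s0: "s 0 = 0"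
    and s: "\<And>\<zeta> i. \<pi> (s \<zeta>) (\<xi>0 $ i) = \<zeta> $ i"
    using transitivity_section[OF indep[folded \<xi>0_def]] by metis
  define \<xi> \<eta> where "\<xi> p = fst p + \<omega> *\<^sub>C snd p" and "\<eta> p = (- \<i>) *\<^sub>C (\<omega> *\<^sub>C snd p - fst p)"
    for p :: "('h ^ 'n) \<times> ('h ^ 'n)"
  define w where "w p = s (\<xi> p - \<xi>0)" for p
  define N where "N = X_u \<inter> {p. norm (w p) < 1/2}"
  define q where "q p = ring_inverse (1 + w p)" for p
  define \<zeta> where "\<zeta> p = amplify (\<pi> (star (1 + w p))) (\<eta> p)" for p
  define h where "h p = star (q p) * g (\<zeta> p) * q p" for p
  define U where "U p = cnj \<omega> *\<^sub>C (2 * cayley_resolvent (h p) - 1)" for p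
  have \<xi>_cont: "continuous_on A \<xi>" and \<eta>_cont: "continuous_on A \<eta>" for A
    unfolding \<xi>_def \<eta>_def by (intro continuous_intros scaleC.continuous_on)+
  have w_cont: "continuous_on A w" for A
    unfolding w_def
    by (intro continuous_on_compose2[OF s_cont] continuous_intros \<xi>_cont) auto
  have a_\<xi>: "\<pi> (1 + w p) (\<xi>0 $ i) = \<xi> p $ i" for p i
    by (simp add: rep_add_left w_def s)
  have inv: "(1 + w p) * q p = 1" "q p * (1 + w p) = 1" "norm (q p) \<le> 2" if p: "p \<in> N" for p
  proof -
    have small: "norm (- w p) < 1" using p by (simp add: N_def)
    obtain b where b: "(1 + w p) * b = 1" "b * (1 + w p) = 1" "norm b \<le> 1 / (1 - norm (w p))"
      using neumann_inverse[OF small] by auto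
    then have "q p = b" unfolding q_def by (intro ring_inverse_eq)
    moreover have "1 / (1 - norm (w p)) \<le> 2" using p by (simp add: N_def field_simps)
    ultimately show "(1 + w p) * q p = 1" "q p * (1 + w p) = 1" "norm (q p) \<le> 2"
      using b by auto
  qed
  have \<zeta>_in: "\<zeta> p \<in> symmetric_images \<xi>0" if p: "p \<in> N" for p
  proof -
    obtain x y where xy: "p = (x, y)" by fastforce
    have gram: "cinner (y $ i) (y $ j) = cinner (x $ i) (x $ j)" for i j
      using p X_u_cinner by (auto simp: N_def xy)
    have "cinner (\<xi> p $ i) (\<eta> p $ j) = cinner (\<eta> p $ i) (\<xi> p $ j)" for i j
    proof -
      have "cnj \<omega> * (\<omega> * c) = c" "\<omega> * (cnj \<omega> * c) = c" for c
        by (simp_all add: \<omega>_cnj flip: mult.assoc)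
      then show ?thesis
        by (simp add: \<xi>_def \<eta>_def xy cinner_simps gram algebra_simps)
    qed
    moreover have "cinner (\<xi>0 $ i) (\<zeta> p $ j) = cinner (\<xi> p $ i) (\<eta> p $ j)" for i j
      by (simp add: \<zeta>_def a_\<xi> flip: rep_adjoint)
    moreover have "cinner (\<zeta> p $ i) (\<xi>0 $ j) = cinner (\<eta> p $ i) (\<xi> p $ j)" for i j
      by (simp add: \<zeta>_def rep_adjoint star_star a_\<xi>)
    ultimately show ?thesis by (simp add: symmetric_images_def)
  qed
  have h_star: "star (h p) = h p" if "p \<in> N" for p
    by (simp add: h_def star_simps g_star[OF \<zeta>_in[OF that]] mult.assoc)
  have h_\<xi>: "\<pi> (h p) (\<xi> p $ i) = \<eta> p $ i" if p: "p \<in> N" for p i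
  proof -
    have "\<pi> (q p) (\<xi> p $ i) = \<xi>0 $ i"
      by (simp add: inv(2)[OF p] flip: a_\<xi> rep_mult)
    then have "\<pi> (h p) (\<xi> p $ i) = \<pi> (star (q p)) (\<zeta> p $ i)"
      by (simp add: h_def rep_mult g[OF \<zeta>_in[OF p]])
    also have "\<dots> = \<pi> (star ((1 + w p) * q p)) (\<eta> p $ i)"
      by (simp add: \<zeta>_def rep_mult star_mult)
    finally show ?thesis by (simp add: inv(1)[OF p])
  qed
  have "openin (top_of_set X_u) N"
    unfolding N_def
    by (intro openin_open_Int open_Collect_less continuous_intros w_cont)
  moreover have "(x0, y0) \<in> N"
    using xy0 by (simp add: N_def w_def \<xi>_def \<xi>0_def s0)
  moreover have "continuous_on N U"
  proof -
    have q_cont: "continuous_on N q"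
    proof (rule continuous_on_iff[THEN iffD2], intro ballI allI impI)
      fix p and e :: real assume p: "p \<in> N" and e: "0 < e"
      obtain d where d: "0 < d" "\<And>p'. dist p' p < d \<Longrightarrow> dist (w p') (w p) < e / 4"
        using w_cont[of UNIV] e unfolding continuous_on_iff by (metis UNIV_I divide_pos_pos zero_less_numeral)
      have "dist (q p') (q p) < e" if p': "p' \<in> N" "dist p' p < d" for p'
      proof -
        have "norm (q p' - q p) \<le> 2\<^sup>2 * norm ((1 + w p') - (1 + w p))"
          by (rule ring_inverse_lipschitz) (use inv[OF p] inv[OF p'(1)] in auto)
        then show ?thesis using d(2)[OF p'(2)] by (simp add: dist_norm)
      qed
      then show "\<exists>d>0. \<forall>p'\<in>N. dist p' p < d \<longrightarrow> dist (q p') (q p) < e" using d(1) by blast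
    qed
    have star_cont: "continuous_on N (\<lambda>p. star (f p))" if "continuous_on N f" for f :: "_ \<Rightarrow> 'a"
      by (rule bounded_linear.continuous_on[OF bounded_linear_star that])
    have "continuous_on N \<zeta>"
      unfolding \<zeta>_def amplify_def
      by (intro continuous_intros bounded_bilinear.continuous_on[OF rep_bounded_bilinear]
          star_cont w_cont \<eta>_cont)
    then have "continuous_on N (\<lambda>p. g (\<zeta> p))"
      by (rule continuous_on_compose2[OF g_cont]) (auto simp: \<zeta>_in)
    then have "continuous_on N h"
      unfolding h_def by (intro continuous_intros star_cont q_cont)
    then have "continuous_on N (\<lambda>p. cayley_resolvent (h p))"
      by (rule continuous_on_compose2[OF continuous_on_cayley_resolvent]) (auto simp: h_star)
    then show ?thesis
      unfolding U_def by (intro continuous_intros scaleC.continuous_on)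
  qed
  moreover have "U p \<in> unitary_elements" if "p \<in> N" for p
    using cayley_resolvent(4)[OF h_star[OF that]] \<omega>_cnj
    by (simp add: unitary_elements_def U_def star_scaleC mult_scaleC_left mult_scaleC_right
        scaleC_scaleC scaleC_one)
  moreover have "\<pi> (U (x, y)) (x $ i) = y $ i" if p: "(x, y) \<in> N" for x y i
  proof -
    have "\<pi> (2 * cayley_resolvent (h (x, y)) - 1) (x $ i) = \<omega> *\<^sub>C (y $ i)"
      using h_\<xi>[OF p, of i] by (intro rep_cayley h_star p) (simp add: \<xi>_def \<eta>_def)
    then show ?thesis by (simp add: U_def rep_scaleC_left scaleC_scaleC \<omega>_cnj scaleC_one)
  qed
  ultimately show ?thesis by (intro exI[of _ N] exI[of _ U]) blast
qed

end

theorem theorem3p11: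
  fixes \<pi> :: "'a::unital_cstar_algebra \<Rightarrow> 'h::chilbert_space \<Rightarrow> 'h"
    and x0 y0 :: "'h ^ 'n::finite"
  assumes "irreducible_representation \<pi>"
    and "nonzero_representation \<pi>"
    and "(x0, y0) \<in> X_u"
  shows "\<exists>(N :: (('h ^ 'n) \<times> ('h ^ 'n)) set) (U :: ('h ^ 'n) \<times> ('h ^ 'n) \<Rightarrow> 'a).
           openin (top_of_set X_u) N \<and> (x0, y0) \<in> N \<and>
           continuous_on N U \<and> U ` N \<subseteq> unitary_elements \<and>
           (\<forall>x y. (x, y) \<in> N \<longrightarrow> (\<forall>i. \<pi> (U (x, y)) (x $ i) = y $ i))"
proof -
  interpret irreducible_rep \<pi>
    by standard (use assms in \<open>simp_all add: irreducible_representation_def\<close>)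
  show ?thesis by (rule local_unitary_section[OF assms(3)])
qed

end
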